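(* Let $[X,\mathcal{B},m,\nu]$ be a reversible random walk space and let $\Omega\in\mathcal{B}$ be $m$-connected with $0<\nu(\Omega)<\nu(\Omega_m)<\infty$, and assume $\Omega$ satisfies a $2$-Poincaré inequality. Then for every $j=1,2,3,\dots$ $$EM^m_j(\Omega)=j!\,\sum_{k=0}^{+\infty}\binom{k+j-1}{j-1}\,g_{m,\Omega}(k).$$
   Context: A random walk $m$ on a measurable space $(X,\mathcal{B})$ ($\mathcal{B}$ countably generated) is a family $(m_x)_{x\in X}$ of probability measures on $\mathcal{B}$ such that $x\mapsto m_x(B)$ is measurable for each $B\in\mathcal{B}$. A $\sigma$-finite measure $\nu$ on $X$ is reversible if $dm_x(y)d\nu(x)=dm_y(x)d\nu(y)$ as measures on $X\times X$; then $[X,\mathcal{B},m,\nu]$ is called a reversible random walk space. For $A,B\in\mathcal{B}$, $L_m(A,B):=\int_A m_x(B)\,d\nu(x)$. For $\Omega\in\mathcal{B}$: $\partial_m\Omega:=\{x\in X\setminus\Omega: m_x(\Omega)>0\}$ and $\Omega_m:=\Omega\cup\partial_m\Omega$. A set $\Omega\in\mathcal B$ with $\nu(\Omega)>0$ is $m$-connected if $L_m(A,B)>0$ for all measurable $A,B\subset\Omega$ of positive $\nu$-measure with $A\cup B=\Omega$. $\Omega$ satisfies a $2$-Poincaré inequality if there is $\lambda>0$ with $\lambda\int_\Omega|f|^2d\nu\le\int_{\Omega_m}\int_{\Omega_m}|f(y)-f(x)|^2dm_x(y)d\nu(x)$ for all $f\in L^2(\Omega_m,\nu)$ with $f=0$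 $\nu$-a.e. on $\partial_m\Omega$. The spectral $m$-heat content is $\mathbb{Q}_\Omega^m(t):=\int_\Omega v(t,x)\,d\nu(x)$, where $v$ is the solution of $\frac{dv}{dt}(t,x)=\int_{\Omega_m}(v(t,y)-v(t,x))\,dm_x(y)$ for $(t,x)\in(0,\infty)\times\Omega$, $v(t,x)=0$ for $(t,x)\in(0,\infty)\times\partial_m\Omega$, $v(0,x)=1$ for $x\in\Omega$. The sequence of exit-$m$-moments of $\Omega$ is $EM^m_j(\Omega):=j\int_0^{+\infty}t^{j-1}\,\mathbb{Q}_\Omega^m(t)\,dt$, $j\in\{1,2,\dots\}$. $g_{m,\Omega}(0):=\nu(\Omega)$ and, for $n\ge1$, $$g_{m,\Omega}(n):=\int_{\Omega^{n+1}}dm_{x_n}(x_{n+1})\cdots dm_{x_1}(x_2)\,d\nu(x_1).$$ *)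

theory Defs
  imports "HOL-Probability.Probability"
begin

text \<open>
  The measurable space \<open>(X, \<B>)\<close> is carried by the measure \<open>\<nu>\<close>:
  \<open>X = space \<nu>\<close> and \<open>\<B> = sets \<nu>\<close>.
\<close>

definition countably_generated :: "'a measure \<Rightarrow> bool" where
  "countably_generated M \<longleftrightarrow>
     (\<exists>E. countable E \<and> E \<subseteq> Pow (space M) \<and> sets M = sigma_sets (space M) E)"

definition random_walk :: "'a measure \<Rightarrow> ('a \<Rightarrow> 'a measure) \<Rightarrow> bool" where
  "random_walk M m \<longleftrightarrow> m \<in> measurable M (prob_algebra M)"

lemma random_walk_iff:
  "random_walk M m \<longleftrightarrow>
     (\<forall>x\<in>space M. prob_space (m x) \<and> sets (m x) = sets M) \<and>
     (\<forall>B\<in>sets M. (\<lambda>x. emeasure (m x) B) \<in> borel_measurable M)"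
proof
  assume "random_walk M m"
  then have m: "m \<in> measurable M (prob_algebra M)" by (simp add: random_walk_def)
  then have "m \<in> measurable M (subprob_algebra M)" by (rule measurable_prob_algebraD)
  then have "(\<lambda>x. emeasure (m x) B) \<in> borel_measurable M" if "B \<in> sets M" for B
    using that by (rule measurable_emeasure_kernel)
  moreover have "prob_space (m x) \<and> sets (m x) = sets M" if "x \<in> space M" for x
    using measurable_space[OF m that] by (auto simp: space_prob_algebra)
  ultimately show "(\<forall>x\<in>space M. prob_space (m x) \<and> sets (m x) = sets M) \<and>
     (\<forall>B\<in>sets M. (\<lambda>x. emeasure (m x) B) \<in> borel_measurable M)" by blast
next
  assume "(\<forall>x\<in>space M. prob_space (m x) \<and> sets (m x) = sets M) \<and>
     (\<forall>B\<in>sets M. (\<lambda>x. emeasure (m x) B) \<in> borel_measurable M)"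
  then show "random_walk M m"
    unfolding random_walk_def
    by (intro measurable_prob_algebraI measurable_subprob_algebra)
       (auto intro: prob_space_imp_subprob_space)
qed

text \<open>Reversibility: \<open>dm_x(y) d\<nu>(x) = dm_y(x) d\<nu>(y)\<close> as measures on \<open>X \<times> X\<close>,
  tested on every set of the product \<open>\<sigma>\<close>-algebra.\<close>

definition reversible :: "'a measure \<Rightarrow> ('a \<Rightarrow> 'a measure) \<Rightarrow> bool" where
  "reversible \<nu> m \<longleftrightarrow>
     (\<forall>C\<in>sets (\<nu> \<Otimes>\<^sub>M \<nu>).
        (\<integral>\<^sup>+x. (\<integral>\<^sup>+y. indicator C (x, y) \<partial>m x) \<partial>\<nu>) =
        (\<integral>\<^sup>+y. (\<integral>\<^sup>+x. indicator C (x, y) \<partial>m y) \<partial>\<nu>))"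

definition reversible_random_walk_space :: "'a measure \<Rightarrow> ('a \<Rightarrow> 'a measure) \<Rightarrow> bool" where
  "reversible_random_walk_space \<nu> m \<longleftrightarrow>
     countably_generated \<nu> \<and> random_walk \<nu> m \<and> sigma_finite_measure \<nu> \<and> reversible \<nu> m"

definition m_interaction ::
    "'a measure \<Rightarrow> ('a \<Rightarrow> 'a measure) \<Rightarrow> 'a set \<Rightarrow> 'a set \<Rightarrow> ennreal" where
  "m_interaction \<nu> m A B = (\<integral>\<^sup>+x\<in>A. emeasure (m x) B \<partial>\<nu>)"

definition m_boundary :: "'a measure \<Rightarrow> ('a \<Rightarrow> 'a measure) \<Rightarrow> 'a set \<Rightarrow> 'a set" where
  "m_boundary \<nu> m \<Omega> = {x \<in> space \<nu> - \<Omega>. emeasure (m x) \<Omega> > 0}"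

definition m_closure :: "'a measure \<Rightarrow> ('a \<Rightarrow> 'a measure) \<Rightarrow> 'a set \<Rightarrow> 'a set" where
  "m_closure \<nu> m \<Omega> = \<Omega> \<union> m_boundary \<nu> m \<Omega>"

definition m_connected :: "'a measure \<Rightarrow> ('a \<Rightarrow> 'a measure) \<Rightarrow> 'a set \<Rightarrow> bool" where
  "m_connected \<nu> m \<Omega> \<longleftrightarrow>
     \<Omega> \<in> sets \<nu> \<and> emeasure \<nu> \<Omega> > 0 \<and>
     (\<forall>A\<in>sets \<nu>. \<forall>B\<in>sets \<nu>.
        emeasure \<nu> A > 0 \<longrightarrow> emeasure \<nu> B > 0 \<longrightarrow> A \<union> B = \<Omega> \<longrightarrow> m_interaction \<nu> m A B > 0)"

definition L2_on :: "'a measure \<Rightarrow> 'a set \<Rightarrow> ('a \<Rightarrow> real) \<Rightarrow> bool" where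
  "L2_on \<nu> A f \<longleftrightarrow> set_borel_measurable \<nu> A f \<and> set_integrable \<nu> A (\<lambda>x. (f x)\<^sup>2)"

definition L2_norm_sq :: "'a measure \<Rightarrow> 'a set \<Rightarrow> ('a \<Rightarrow> real) \<Rightarrow> ennreal" where
  "L2_norm_sq \<nu> A f = (\<integral>\<^sup>+x\<in>A. ennreal ((f x)\<^sup>2) \<partial>\<nu>)"

definition poincare2 :: "'a measure \<Rightarrow> ('a \<Rightarrow> 'a measure) \<Rightarrow> 'a set \<Rightarrow> bool" where
  "poincare2 \<nu> m \<Omega> \<longleftrightarrow>
     (\<exists>l>0. \<forall>f. L2_on \<nu> (m_closure \<nu> m \<Omega>) f \<longrightarrow> (AE x\<in>m_boundary \<nu> m \<Omega> in \<nu>. f x = 0) \<longrightarrow>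
        ennreal l * L2_norm_sq \<nu> \<Omega> f \<le>
        (\<integral>\<^sup>+x\<in>m_closure \<nu> m \<Omega>.
           (\<integral>\<^sup>+y\<in>m_closure \<nu> m \<Omega>. ennreal (\<bar>f y - f x\<bar>\<^sup>2) \<partial>m x) \<partial>\<nu>))"

text \<open>
  Solutions of the homogeneous Dirichlet problem for the \<open>m\<close>-heat flow with initial datum \<open>1\<close>
  are understood in the semigroup sense: \<open>t \<mapsto> v(t)\<close> is continuous on \<open>[0, \<infinity>)\<close> and differentiable
  on \<open>(0, \<infinity>)\<close> as a map into \<open>L\<^sup>2(\<Omega>, \<nu>)\<close>, and the equalities between functions of \<open>x\<close> hold
  \<open>\<nu>\<close>-almost everywhere. (Continuity at positive times follows from differentiability.)
\<close>

definition heat_solution ::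
    "'a measure \<Rightarrow> ('a \<Rightarrow> 'a measure) \<Rightarrow> 'a set \<Rightarrow> (real \<Rightarrow> 'a \<Rightarrow> real) \<Rightarrow> bool" where
  "heat_solution \<nu> m \<Omega> v \<longleftrightarrow>
     (\<forall>t\<ge>0. L2_on \<nu> (m_closure \<nu> m \<Omega>) (v t)) \<and>
     (\<forall>t>0.
        ((\<lambda>h. L2_norm_sq \<nu> \<Omega>
           (\<lambda>x. (v (t + h) x - v t x) / h - (LINT y:m_closure \<nu> m \<Omega>|m x. v t y - v t x)))
         \<longlongrightarrow> 0) (at 0)) \<and>
     (\<forall>t>0. AE x\<in>m_boundary \<nu> m \<Omega> in \<nu>. v t x = 0) \<and>
     (AE x\<in>\<Omega> in \<nu>. v 0 x = 1) \<and>
     ((\<lambda>t. L2_norm_sq \<nu> \<Omega> (\<lambda>x. v t x - v 0 x)) \<longlongrightarrow> 0) (at_right 0)"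

text \<open>The solution is unique only up to \<open>\<nu>\<close>-null sets, hence the choice of a representative.\<close>

definition spectral_heat_content ::
    "'a measure \<Rightarrow> ('a \<Rightarrow> 'a measure) \<Rightarrow> 'a set \<Rightarrow> real \<Rightarrow> real" where
  "spectral_heat_content \<nu> m \<Omega> t = (LINT x:\<Omega>|\<nu>. (SOME v. heat_solution \<nu> m \<Omega> v) t x)"

definition exit_moment :: "'a measure \<Rightarrow> ('a \<Rightarrow> 'a measure) \<Rightarrow> 'a set \<Rightarrow> nat \<Rightarrow> real" where
  "exit_moment \<nu> m \<Omega> j =
     real j * (LINT t:{0..}|lborel. t ^ (j - 1) * spectral_heat_content \<nu> m \<Omega> t)"

text \<open>\<open>iterated_kernel m \<Omega> n x\<^sub>1 = \<integral>\<^bsub>\<Omega>\<^esub> \<dots> \<integral>\<^bsub>\<Omega>\<^esub> dm_{x_n}(x_{n+1}) \<dots> dm_{x_1}(x_2)\<close>,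
  integrating over \<open>n\<close> variables.\<close>

primrec iterated_kernel :: "('a \<Rightarrow> 'a measure) \<Rightarrow> 'a set \<Rightarrow> nat \<Rightarrow> 'a \<Rightarrow> real" where
  "iterated_kernel m \<Omega> 0 x = 1"
| "iterated_kernel m \<Omega> (Suc n) x = (LINT y:\<Omega>|m x. iterated_kernel m \<Omega> n y)"

definition g_seq :: "'a measure \<Rightarrow> ('a \<Rightarrow> 'a measure) \<Rightarrow> 'a set \<Rightarrow> nat \<Rightarrow> real" where
  "g_seq \<nu> m \<Omega> n = (LINT x:\<Omega>|\<nu>. iterated_kernel m \<Omega> n x)"

lemma g_seq_0: "\<Omega> \<in> sets \<nu> \<Longrightarrow> g_seq \<nu> m \<Omega> 0 = measure \<nu> \<Omega>"
  by (simp add: g_seq_def set_lebesgue_integral_def)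

end

theory Submission
  imports Defs "HOL-Analysis.Generalised_Binomial_Theorem"
begin

text \<open>
  Write \<open>k\<^sub>n\<close> for the iterated kernels and \<open>K f(x) = \<integral>\<^bsub>\<Omega>\<^esub> f dm\<^sub>x\<close>, so that \<open>k\<^sub>n = K\<^sup>n 1\<close> and the heat
  equation on \<open>\<Omega>\<close> reads \<open>v' = K v - v\<close>. If \<open>v\<close> is any solution, then by reversibility
  \<open>a\<^sub>n(t) = \<integral>\<^bsub>\<Omega>\<^esub> v(t) k\<^sub>n d\<nu>\<close> satisfies \<open>a\<^sub>n' = a\<^sub>n\<^sub>+\<^sub>1 - a\<^sub>n\<close> and \<open>a\<^sub>n(0) = g(n)\<close>; as the \<open>a\<^sub>n\<close> are
  locally bounded uniformly in \<open>n\<close>, Taylor's theorem gives \<open>a\<^sub>0(t) = e\<^sup>-\<^sup>t \<Sum>\<^sub>n g(n) t\<^sup>n / n!\<close>, the heat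
  content. Integrating against \<open>t\<^sup>j\<^sup>-\<^sup>1\<close> term by term yields the formula. Convergence comes from the
  Poincare inequality for \<open>k\<^sub>n\<close>: since \<open>g(a + b) = \<integral>\<^bsub>\<Omega>\<^esub> k\<^sub>a k\<^sub>b d\<nu>\<close>, it says that
  \<open>g(2n + 1) \<le> (1 - \<lambda>/2) g(2n)\<close>, so \<open>g\<close> decays geometrically.
\<close>

section \<open>Exponentially weighted power series\<close>

text \<open>For t \<ge> 0 this is the mean of \<open>c\<close> under the Poisson distribution with
  parameter t.\<close>

definition exp_weighted :: "(nat \<Rightarrow> real) \<Rightarrow> real \<Rightarrow> real" where
  "exp_weighted c t = exp (- t) * (\<Sum>n. c n / fact n * t ^ n)"

lemma summable_exp_weighted:
  fixes c :: "nat \<Rightarrow> real"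
  assumes "\<And>n. \<bar>c n\<bar> \<le> B"
  shows "summable (\<lambda>n. c n / fact n * t ^ n)"
proof (rule summable_comparison_test')
  show "summable (\<lambda>n. B * (inverse (fact n) * \<bar>t\<bar> ^ n))"
    using summable_exp[of "\<bar>t\<bar>"] by (intro summable_mult) auto
  show "norm (c n / fact n * t ^ n) \<le> B * (inverse (fact n) * \<bar>t\<bar> ^ n)" for n
    using mult_right_mono[OF assms[of n], of "inverse (fact n) * \<bar>t\<bar> ^ n"]
    by (simp add: abs_mult power_abs field_simps)
qed

lemma exp_weighted_diff:
  assumes "\<And>n. \<bar>c n\<bar> \<le> B" "\<And>n. \<bar>d n\<bar> \<le> C"
  shows "exp_weighted (\<lambda>n. c n - d n) t = exp_weighted c t - exp_weighted d t"
  using suminf_diff[OF summable_exp_weighted[of c B t, OF assms(1)] summable_exp_weighted[of d C t, OF assms(2)]]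
  by (simp add: exp_weighted_def algebra_simps diff_divide_distrib)

text \<open>The Poisson weights are nonnegative for t \<ge> 0 and sum to 1, so averaging keeps the
  bound of the coefficients.\<close>

lemma abs_exp_weighted_le:
  assumes "\<And>n. \<bar>c n\<bar> \<le> B" "0 \<le> t"
  shows "\<bar>exp_weighted c t\<bar> \<le> B"
proof -
  have "\<bar>\<Sum>n. c n / fact n * t ^ n\<bar> \<le> (\<Sum>n. B * (inverse (fact n) * t ^ n))"
  proof (rule norm_suminf_le[where 'a=real, unfolded real_norm_def])
    show "summable (\<lambda>n. B * (inverse (fact n) * t ^ n))"
      using summable_exp[of t] by (intro summable_mult) auto
    show "\<bar>c n / fact n * t ^ n\<bar> \<le> B * (inverse (fact n) * t ^ n)" for n
      using mult_right_mono[OF assms(1)[of n], of "inverse (fact n) * t ^ n"] assms(2)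
      by (simp add: abs_mult power_abs field_simps)
  qed
  also have "\<dots> = B * exp t"
    using exp_converges[of t] by (simp add: sums_iff suminf_mult divide_inverse scaleR_conv_of_real)
  finally show ?thesis
    by (simp add: exp_weighted_def abs_mult exp_minus field_simps)
qed

text \<open>Differentiating the power series shifts its coefficients by one, and the factor
  \<open>exp (- t)\<close> contributes the term with a minus sign.\<close>

lemma has_real_derivative_exp_weighted:
  assumes "\<And>n. \<bar>c n\<bar> \<le> B"
  shows "(exp_weighted c has_real_derivative exp_weighted (\<lambda>n. c (Suc n) - c n) t) (at t)"
proof -
  have "diffs (\<lambda>n. c n / fact n) = (\<lambda>n. c (Suc n) / fact n)"
    by (simp add: diffs_def fun_eq_iff del: of_nat_Suc)
  moreover have "((\<lambda>t. \<Sum>n. c n / fact n * t ^ n) has_real_derivative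
      (\<Sum>n. diffs (\<lambda>n. c n / fact n) n * t ^ n)) (at t)"
    by (rule termdiffs_strong_converges_everywhere) (rule summable_exp_weighted[OF assms])
  ultimately have *: "((\<lambda>t. \<Sum>n. c n / fact n * t ^ n) has_real_derivative
      (\<Sum>n. c (Suc n) / fact n * t ^ n)) (at t)" by simp
  have "exp_weighted (\<lambda>n. c (Suc n) - c n) t
      = exp_weighted (\<lambda>n. c (Suc n)) t - exp_weighted c t"
    by (rule exp_weighted_diff[OF assms assms])
  \<comment> \<open>With the sums hidden behind \<open>F\<close>, the differentiation rules treat
    them as atoms.\<close>
  moreover define F where "F c t = (\<Sum>n. c n / fact n * t ^ n)" for c :: "nat \<Rightarrow> real" and t
  ultimately show ?thesis
    using * unfolding exp_weighted_def F_def[symmetric]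
    by (auto intro!: derivative_eq_intros simp: algebra_simps)
qed

lemma exp_weighted_0: "exp_weighted c 0 = c 0"
  using powser_zero[of "\<lambda>n. c n / fact n"] by (simp add: exp_weighted_def)

text \<open>The derivative is again a Poisson average, of differences bounded by 2B; the mean value
  inequality on the half-line does the rest.\<close>

lemma abs_exp_weighted_diff_le:
  assumes c: "\<And>n. \<bar>c n\<bar> \<le> B" and "0 \<le> s" "0 \<le> t"
  shows "\<bar>exp_weighted c s - exp_weighted c t\<bar> \<le> 2 * B * \<bar>s - t\<bar>"
proof -
  have "\<bar>c (Suc n) - c n\<bar> \<le> 2 * B" for n using c[of n] c[of "Suc n"] by linarith
  then have "\<bar>exp_weighted (\<lambda>n. c (Suc n) - c n) r\<bar> \<le> 2 * B" if "0 \<le> r" for r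
    using that by (intro abs_exp_weighted_le)
  moreover have "(exp_weighted c has_real_derivative exp_weighted (\<lambda>n. c (Suc n) - c n) r) (at r within {0..})" for r
    by (rule has_field_derivative_at_within) (rule has_real_derivative_exp_weighted[OF c])
  ultimately show ?thesis
    using field_differentiable_bound[of "{0..}" "exp_weighted c" "exp_weighted (\<lambda>n. c (Suc n) - c n)" "2 * B" s t]
      assms(2,3)
    by simp
qed

text \<open>By the mean value theorem the quotient is the derivative at an intermediate point, and
  the derivative is Lipschitz with constant 2 (2B). The error depends on \<open>c\<close> through
  \<open>B\<close> only, so it is uniform in x once the coefficients depend on x.\<close>

lemma exp_weighted_difference_quotient:
  assumes c: "\<And>n. \<bar>c n\<bar> \<le> B" and "0 < t" "\<bar>h\<bar> < t" "h \<noteq> 0"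
  shows "\<bar>(exp_weighted c (t + h) - exp_weighted c t) / h
           - exp_weighted (\<lambda>n. c (Suc n) - c n) t\<bar> \<le> 4 * B * \<bar>h\<bar>"
proof -
  define d where "d n = c (Suc n) - c n" for n
  have d: "\<bar>d n\<bar> \<le> 2 * B" for n using c[of n] c[of "Suc n"] by (simp add: d_def)
  have Dd: "(exp_weighted c has_real_derivative exp_weighted d s) (at s)" for s
    using has_real_derivative_exp_weighted[of c B s, OF c] unfolding d_def .
  \<comment> \<open>The condition on \<open>h\<close> keeps \<open>?S\<close> in the nonnegative
    half-line, where the Lipschitz estimate is available.\<close>
  let ?S = "{t - \<bar>h\<bar> .. t + \<bar>h\<bar>}"
  have lip: "\<bar>exp_weighted d x - exp_weighted d t\<bar> \<le> 4 * B * \<bar>x - t\<bar>" if "x \<in> ?S" for x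
    using abs_exp_weighted_diff_le[of d "2 * B" x t, OF d] assms that by auto
  obtain z where z: "z \<in> ?S" "exp_weighted c (t + h) - exp_weighted c t = h * exp_weighted d z"
  proof (cases "h > 0")
    case True
    then obtain z where "t < z" "z < t + h"
      "exp_weighted c (t + h) - exp_weighted c t = (t + h - t) * exp_weighted d z"
      using MVT2[of t "t + h" "exp_weighted c" "exp_weighted d"] Dd by auto
    then show ?thesis using that[of z] True by auto
  next
    case False
    then have "t + h < t" using assms by auto
    then obtain z where "t + h < z" "z < t"
      "exp_weighted c t - exp_weighted c (t + h) = (t - (t + h)) * exp_weighted d z"
      using MVT2[of "t + h" t "exp_weighted c" "exp_weighted d"] Dd by auto
    then show ?thesis using that[of z] False by (auto simp: algebra_simps)
  qed
  have "0 \<le> B" using c[of 0] by linarith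
  have "\<bar>exp_weighted d z - exp_weighted d t\<bar> \<le> 4 * B * \<bar>z - t\<bar>" by (rule lip[OF z(1)])
  also have "\<dots> \<le> 4 * B * \<bar>h\<bar>" using z(1) \<open>0 \<le> B\<close> by (intro mult_left_mono) auto
  finally show ?thesis using z(2) assms(4) unfolding d_def[symmetric] by simp
qed

section \<open>Uniqueness for the infinite linear system\<close>

text \<open>Multiplication by \<open>exp t\<close> turns the system into b_n' = b_(n+1), so b_n is
  the n-th derivative of b_0. Since \<open>L\<close> does not depend on n, the Taylor remainders of
  b_0 tend to 0, and b_0 is determined by the initial values.\<close>

lemma exp_weighted_unique:
  fixes a :: "nat \<Rightarrow> real \<Rightarrow> real" and L :: "real \<Rightarrow> real"
  assumes deriv: "\<And>n t. t > 0 \<Longrightarrow> (a n has_real_derivative a (Suc n) t - a n t) (at t)"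
    and lim0: "\<And>n. (a n \<longlongrightarrow> a n 0) (at_right 0)"
    and bound: "\<And>n t. 0 \<le> t \<Longrightarrow> \<bar>a n t\<bar> \<le> L t"
    and cont: "continuous_on {0..} L"
    and "0 \<le> t"
  shows "a 0 t = exp_weighted (\<lambda>n. a n 0) t"
proof (cases "t = 0")
  case True
  then show ?thesis by (simp add: exp_weighted_0)
next
  case False
  then have t: "0 < t" using assms by simp
  define b where "b n s = exp s * a n s" for n s
  have Db: "(b n has_real_derivative b (Suc n) s) (at s)" if "s > 0" for n s
    unfolding b_def by (auto intro!: derivative_eq_intros deriv that simp: algebra_simps)
  obtain C where C: "\<And>s. s \<in> {0..t} \<Longrightarrow> \<bar>L s\<bar> \<le> C"
    using compact_imp_bounded[OF compact_continuous_image[OF continuous_on_subset[OF cont] compact_Icc[of 0 t]]]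
    by (force simp: bounded_iff)
  have bC: "\<bar>b n s\<bar> \<le> exp t * C" if "0 \<le> s" "s \<le> t" for n s
    unfolding b_def abs_mult using that bound[of s n] C[of s]
    by (intro mult_mono) auto
  \<comment> \<open>Two-sided derivatives exist only on the open half-line: expand at \<open>e > 0\<close> and let \<open>e\<close> tend to 0.\<close>
  have key: "\<bar>b 0 t - (\<Sum>k<N. b k 0 / fact k * t ^ k)\<bar> \<le> exp t * C / fact N * t ^ N"
    (is "?l \<le> ?r") if "N > 0" for N
  proof (rule tendsto_upperbound)
    have b0: "(b n \<longlongrightarrow> b n 0) (at_right 0)" for n
      unfolding b_def by (intro tendsto_intros lim0)
    show "((\<lambda>e. \<bar>b 0 t - (\<Sum>k<N. b k e / fact k * (t - e) ^ k)\<bar>) \<longlongrightarrow> ?l) (at_right 0)"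
      by (rule tendsto_eq_intros b0 refl | simp)+
    have "eventually (\<lambda>e. e \<in> {0<..<t}) (at_right 0)"
      using eventually_at_right_real[OF t] .
    then show "eventually (\<lambda>e. \<bar>b 0 t - (\<Sum>k<N. b k e / fact k * (t - e) ^ k)\<bar> \<le> ?r) (at_right 0)"
    proof eventually_elim
      case (elim e)
      have "\<exists>s. e < s \<and> s < t \<and> b 0 t = (\<Sum>k<N. b k e / fact k * (t - e) ^ k) + b N s / fact N * (t - e) ^ N"
        using elim that by (intro Taylor_up[where a = e]) (auto intro: Db)
      then obtain s where s: "e < s" "s < t"
        "b 0 t = (\<Sum>k<N. b k e / fact k * (t - e) ^ k) + b N s / fact N * (t - e) ^ N" by blast
      have "\<bar>b N s / fact N * (t - e) ^ N\<bar> \<le> ?r"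
      proof -
        have "0 \<le> exp t * C" using s elim bC[of s N] by (intro order_trans[OF abs_ge_zero bC[of s N]]) auto
        moreover have "\<bar>b N s\<bar> / fact N \<le> exp t * C / fact N"
          using s elim bC[of s N] by (intro divide_right_mono) auto
        ultimately show ?thesis
          unfolding abs_mult abs_divide power_abs using s elim
          by (intro mult_mono power_mono) auto
      qed
      then show ?case using s(3) by simp
    qed
  qed simp
  \<comment> \<open>The remainder bound is a constant times a term of the exponential
    series.\<close>
  have "(\<lambda>N. exp t * C * (t ^ N / fact N)) \<longlonglongrightarrow> exp t * C * 0"
    using summable_LIMSEQ_zero[OF summable_exp[of t]] by (intro tendsto_intros) (simp add: field_simps)
  then have lim: "(\<lambda>N. exp t * C / fact N * t ^ N) \<longlonglongrightarrow> 0" by (simp add: field_simps)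
  have "(\<lambda>N. (\<Sum>k<N. b k 0 / fact k * t ^ k) - b 0 t) \<longlonglongrightarrow> 0"
  proof (rule Lim_null_comparison[OF _ lim])
    show "\<forall>\<^sub>F N in sequentially. norm ((\<Sum>k<N. b k 0 / fact k * t ^ k) - b 0 t) \<le> exp t * C / fact N * t ^ N"
      using eventually_gt_at_top[of 0]
    proof eventually_elim
      case (elim N)
      then show ?case using key[of N] by (simp only: real_norm_def abs_minus_commute)
    qed
  qed
  then have "(\<lambda>k. b k 0 / fact k * t ^ k) sums b 0 t"
    unfolding sums_def using Lim_null by blast
  then show ?thesis
    by (simp add: sums_iff exp_weighted_def b_def exp_minus)
qed

section \<open>Negative binomial series and moments\<close>

text \<open>This is Newton's series for (1 - r)^(-j): by symmetry and upper negation the coefficient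
  is the generalised binomial of -j over k, up to the sign that (-r)^k absorbs.\<close>

lemma summable_negative_binomial:
  fixes r :: real
  assumes "\<bar>r\<bar> < 1" "j \<ge> 1"
  shows "summable (\<lambda>k. real ((k + j - 1) choose (j - 1)) * r ^ k)"
proof -
  have "real ((k + j - 1) choose (j - 1)) * r ^ k = ((- real j) gchoose k) * (- r) ^ k" for k
  proof -
    have "(k + j - 1) choose (j - 1) = (k + j - 1) choose k"
      using assms(2) by (subst binomial_symmetric) auto
    moreover have "real ((k + j - 1) choose k) = (real j + real k - 1) gchoose k"
      using assms(2) by (subst binomial_gbinomial) (simp add: of_nat_diff add.commute)
    moreover have "(- 1) ^ k * (- r) ^ k = r ^ k"
      by (simp add: power_mult_distrib[symmetric])
    ultimately show ?thesis
      by (simp add: gbinomial_minus)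
  qed
  then show ?thesis
    using gen_binomial_real[of "- r" "- real j"] assms(1) by (simp add: sums_iff)
qed

text \<open>The k-th term is a Gamma integral with value (k + j - 1)!; division by k! leaves (j -
  1)! times the binomial coefficient. All terms are nonnegative, so sum and integral may be
  interchanged in \<open>ennreal\<close>.\<close>

lemma integral_exp_weighted_moment:
  fixes c :: "nat \<Rightarrow> real"
  assumes c: "\<And>n. 0 \<le> c n" "\<And>n. c n \<le> B" and "j \<ge> 1"
    and summ: "summable (\<lambda>k. real ((k + j - 1) choose (j - 1)) * c k)"
  shows "set_integrable lborel {0..} (\<lambda>t. t ^ (j - 1) * exp_weighted c t)"
    and "(LINT t:{0..}|lborel. t ^ (j - 1) * exp_weighted c t) =
           fact (j - 1) * (\<Sum>k. real ((k + j - 1) choose (j - 1)) * c k)"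
proof -
  have cB: "\<bar>c n\<bar> \<le> B" for n using c by auto
  let ?s = "\<Sum>k. real ((k + j - 1) choose (j - 1)) * c k"
  have moment_k: "(\<integral>\<^sup>+t. ennreal (c k / fact k * (t ^ (k + j - 1) * exp (- t))) * indicator {0..} t \<partial>lborel)
      = ennreal (fact (j - 1) * (real ((k + j - 1) choose (j - 1)) * c k))" for k
  proof -
    have "(\<integral>\<^sup>+t. ennreal (c k / fact k * (t ^ (k + j - 1) * exp (- t))) * indicator {0..} t \<partial>lborel)
      = (\<integral>\<^sup>+t. ennreal (c k / fact k) * (ennreal (t ^ (k + j - 1) * exp (- t)) * indicator {0..} t) \<partial>lborel)"
    proof (intro nn_integral_cong)
      fix t :: real
      show "ennreal (c k / fact k * (t ^ (k + j - 1) * exp (- t))) * indicator {0..} t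
        = ennreal (c k / fact k) * (ennreal (t ^ (k + j - 1) * exp (- t)) * indicator {0..} t)"
      proof (cases "0 \<le> t")
        case True
        have "ennreal (c k / fact k * (t ^ (k + j - 1) * exp (- t))) =
          ennreal (c k / fact k) * ennreal (t ^ (k + j - 1) * exp (- t))"
          using True c by (intro ennreal_mult) auto
        then show ?thesis using True by simp
      qed simp
    qed
    also have "\<dots> = ennreal (c k / fact k) * ennreal (fact (k + j - 1))"
      by (subst nn_integral_cmult) (auto simp: nn_intergal_power_times_exp_Ici)
    also have "\<dots> = ennreal (c k / fact k * fact (k + j - 1))"
      using c by (subst ennreal_mult) auto
    also have "c k / fact k * fact (k + j - 1) = fact (j - 1) * (real ((k + j - 1) choose (j - 1)) * c k)"
      using \<open>j \<ge> 1\<close> by (subst binomial_fact) (auto simp: field_simps)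
    finally show ?thesis .
  qed
  have nn: "(\<integral>\<^sup>+t. ennreal (indicator {0..} t *\<^sub>R (t ^ (j - 1) * exp_weighted c t)) \<partial>lborel)
     = ennreal (fact (j - 1) * ?s)"
  proof -
    have "(\<integral>\<^sup>+t. ennreal (indicator {0..} t *\<^sub>R (t ^ (j - 1) * exp_weighted c t)) \<partial>lborel)
      = (\<integral>\<^sup>+t. (\<Sum>k. ennreal (c k / fact k * (t ^ (k + j - 1) * exp (- t))) * indicator {0..} t) \<partial>lborel)"
    proof (intro nn_integral_cong)
      fix t :: real
      show "ennreal (indicator {0..} t *\<^sub>R (t ^ (j - 1) * exp_weighted c t)) =
        (\<Sum>k. ennreal (c k / fact k * (t ^ (k + j - 1) * exp (- t))) * indicator {0..} t)"
      proof (cases "0 \<le> t")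
        case True
        have eq: "c k / fact k * (t ^ (k + j - 1) * exp (- t)) = (t ^ (j - 1) * exp (- t)) * (c k / fact k * t ^ k)" for k
        proof -
          \<comment> \<open>Subtraction on naturals is truncated, so this regrouping rests on j
            \<ge> 1.\<close>
          have "k + j - 1 = (j - 1) + k" using \<open>j \<ge> 1\<close> by simp
          then have "t ^ (k + j - 1) = t ^ (j - 1) * t ^ k" by (simp only: power_add)
          then show ?thesis by simp
        qed
        have s: "(\<lambda>k. (t ^ (j - 1) * exp (- t)) * (c k / fact k * t ^ k)) sums
          ((t ^ (j - 1) * exp (- t)) * (\<Sum>k. c k / fact k * t ^ k))"
          by (intro sums_mult summable_sums summable_exp_weighted[OF cB])
        have "(\<Sum>k. ennreal ((t ^ (j - 1) * exp (- t)) * (c k / fact k * t ^ k)))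
           = ennreal ((t ^ (j - 1) * exp (- t)) * (\<Sum>k. c k / fact k * t ^ k))"
          using s c True by (subst suminf_ennreal2) (auto simp: sums_iff)
        then show ?thesis
          using True unfolding eq exp_weighted_def by (simp add: mult.assoc)
      qed simp
    qed
    also have "\<dots> = (\<Sum>k. \<integral>\<^sup>+t. ennreal (c k / fact k * (t ^ (k + j - 1) * exp (- t))) * indicator {0..} t \<partial>lborel)"
      by (intro nn_integral_suminf) auto
    also have "\<dots> = (\<Sum>k. ennreal (fact (j - 1) * (real ((k + j - 1) choose (j - 1)) * c k)))"
      by (simp only: moment_k)
    also have "\<dots> = ennreal (\<Sum>k. fact (j - 1) * (real ((k + j - 1) choose (j - 1)) * c k))"
      using c summ by (intro suminf_ennreal2) (auto intro!: summable_mult)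
    also have "\<dots> = ennreal (fact (j - 1) * ?s)"
      using summ by (subst suminf_mult) auto
    finally show ?thesis .
  qed
  have pos: "0 \<le> exp_weighted c t" if "0 \<le> t" for t
    unfolding exp_weighted_def using that c
    by (intro mult_nonneg_nonneg suminf_nonneg summable_exp_weighted[OF cB]) auto
  have s0: "0 \<le> ?s" using c summ by (intro suminf_nonneg) auto
  have [measurable]: "exp_weighted c \<in> borel_measurable borel"
    by (intro borel_measurable_continuous_onI continuous_at_imp_continuous_on ballI
        DERIV_isCont[OF has_real_derivative_exp_weighted[OF cB]])
  \<comment> \<open>A nonnegative function with a finite \<open>ennreal\<close> integral:
    integrability and value come out together.\<close>
  have "has_bochner_integral lborel (\<lambda>t. indicator {0..} t *\<^sub>R (t ^ (j - 1) * exp_weighted c t)) (fact (j - 1) * ?s)"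
    using s0 pos nn by (intro has_bochner_integral_nn_integral) (auto split: split_indicator)
  then show "set_integrable lborel {0..} (\<lambda>t. t ^ (j - 1) * exp_weighted c t)"
    "(LINT t:{0..}|lborel. t ^ (j - 1) * exp_weighted c t) = fact (j - 1) * ?s"
    by (auto simp: has_bochner_integral_iff set_integrable_def set_lebesgue_integral_def)
qed

section \<open>Reversible random walks\<close>

locale reversible_walk = sigma_finite_measure \<nu>
  for \<nu> :: "'a measure" and m :: "'a \<Rightarrow> 'a measure" +
  assumes kernel [measurable]: "m \<in> measurable \<nu> (prob_algebra \<nu>)"
    and reversible: "reversible \<nu> m"
begin

lemma kernel_subprob [measurable]: "m \<in> measurable \<nu> (subprob_algebra \<nu>)"
  by (rule measurable_prob_algebraD[OF kernel])

lemma prob_space_kernel: "x \<in> space \<nu> \<Longrightarrow> prob_space (m x)"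
  and sets_walk [measurable_cong]: "x \<in> space \<nu> \<Longrightarrow> sets (m x) = sets \<nu>"
  using measurable_space[OF kernel] by (auto simp: space_prob_algebra)

lemma space_walk: "x \<in> space \<nu> \<Longrightarrow> space (m x) = space \<nu>"
  using sets_walk by (rule sets_eq_imp_space_eq)

lemma measurable_kernel: "x \<in> space \<nu> \<Longrightarrow> measurable (m x) N = measurable \<nu> N"
  using sets_walk by (intro measurable_cong_sets) auto

lemma borel_measurable_nn_integral_kernel [measurable]:
  assumes "case_prod F \<in> borel_measurable (\<nu> \<Otimes>\<^sub>M \<nu>)"
  shows "(\<lambda>x. \<integral>\<^sup>+y. F x y \<partial>m x) \<in> borel_measurable \<nu>"
  using assms kernel_subprob by (rule nn_integral_measurable_subprob_algebra2)

lemma borel_measurable_integral_kernel [measurable]: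
  fixes f :: "'a \<Rightarrow> real"
  assumes [measurable]: "f \<in> borel_measurable \<nu>"
  shows "(\<lambda>x. LINT y|m x. f y) \<in> borel_measurable \<nu>"
  by measurable

text \<open>Reversibility is given on indicators of product sets in the sigma-algebra; it passes
  through scalar multiples, sums and monotone limits.\<close>

lemma reversible_nn_integral:
  assumes "case_prod F \<in> borel_measurable (\<nu> \<Otimes>\<^sub>M \<nu>)"
  shows "(\<integral>\<^sup>+x. \<integral>\<^sup>+y. F x y \<partial>m x \<partial>\<nu>) = (\<integral>\<^sup>+x. \<integral>\<^sup>+y. F y x \<partial>m x \<partial>\<nu>)"
proof -
  have "(\<integral>\<^sup>+x. \<integral>\<^sup>+y. G (x, y) \<partial>m x \<partial>\<nu>) = (\<integral>\<^sup>+x. \<integral>\<^sup>+y. G (y, x) \<partial>m x \<partial>\<nu>)"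
    if "G \<in> borel_measurable (\<nu> \<Otimes>\<^sub>M \<nu>)" for G
    using that
  proof (induction rule: borel_measurable_induct)
    case (cong f g)
    have "(\<integral>\<^sup>+x. \<integral>\<^sup>+y. f (x, y) \<partial>m x \<partial>\<nu>) = (\<integral>\<^sup>+x. \<integral>\<^sup>+y. g (x, y) \<partial>m x \<partial>\<nu>)"
      "(\<integral>\<^sup>+x. \<integral>\<^sup>+y. f (y, x) \<partial>m x \<partial>\<nu>) = (\<integral>\<^sup>+x. \<integral>\<^sup>+y. g (y, x) \<partial>m x \<partial>\<nu>)"
      using cong(3) by (auto intro!: nn_integral_cong simp: space_pair_measure space_walk)
    with cong(4) show ?case by simp
  next
    case (set A)
    then show ?case using reversible by (auto simp: reversible_def)
  next
    case (mult u c)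
    note [measurable] = mult(2)
    have "(\<integral>\<^sup>+x. \<integral>\<^sup>+y. c * u (x, y) \<partial>m x \<partial>\<nu>) = (\<integral>\<^sup>+x. c * (\<integral>\<^sup>+y. u (x, y) \<partial>m x) \<partial>\<nu>)"
      "(\<integral>\<^sup>+x. \<integral>\<^sup>+y. c * u (y, x) \<partial>m x \<partial>\<nu>) = (\<integral>\<^sup>+x. c * (\<integral>\<^sup>+y. u (y, x) \<partial>m x) \<partial>\<nu>)"
      by (auto intro!: nn_integral_cong nn_integral_cmult simp: measurable_kernel)
    with mult show ?case by (simp add: nn_integral_cmult)
  next
    case (add u v)
    note [measurable] = \<open>u \<in> borel_measurable (\<nu> \<Otimes>\<^sub>M \<nu>)\<close> \<open>v \<in> borel_measurable (\<nu> \<Otimes>\<^sub>M \<nu>)\<close>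
    have "(\<integral>\<^sup>+x. \<integral>\<^sup>+y. v (x, y) + u (x, y) \<partial>m x \<partial>\<nu>) = (\<integral>\<^sup>+x. (\<integral>\<^sup>+y. v (x, y) \<partial>m x) + (\<integral>\<^sup>+y. u (x, y) \<partial>m x) \<partial>\<nu>)"
      "(\<integral>\<^sup>+x. \<integral>\<^sup>+y. v (y, x) + u (y, x) \<partial>m x \<partial>\<nu>) = (\<integral>\<^sup>+x. (\<integral>\<^sup>+y. v (y, x) \<partial>m x) + (\<integral>\<^sup>+y. u (y, x) \<partial>m x) \<partial>\<nu>)"
      by (auto intro!: nn_integral_cong nn_integral_add simp: measurable_kernel)
    with add show ?case by (simp add: nn_integral_add)
  next
    case (seq U)
    note [measurable] = seq(1)
    have inc1: "incseq (\<lambda>i y. U i (x, y))" "incseq (\<lambda>i y. U i (y, x))" for x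
      using seq(3) by (auto simp: incseq_def le_fun_def)
    have inc2: "incseq (\<lambda>i x. \<integral>\<^sup>+y. U i (x, y) \<partial>m x)" "incseq (\<lambda>i x. \<integral>\<^sup>+y. U i (y, x) \<partial>m x)"
      using seq(3) by (auto simp: incseq_def le_fun_def intro!: nn_integral_mono)
    have "(\<integral>\<^sup>+x. \<integral>\<^sup>+y. (SUP i. U i (x, y)) \<partial>m x \<partial>\<nu>) = (\<integral>\<^sup>+x. (SUP i. \<integral>\<^sup>+y. U i (x, y) \<partial>m x) \<partial>\<nu>)"
      "(\<integral>\<^sup>+x. \<integral>\<^sup>+y. (SUP i. U i (y, x)) \<partial>m x \<partial>\<nu>) = (\<integral>\<^sup>+x. (SUP i. \<integral>\<^sup>+y. U i (y, x) \<partial>m x) \<partial>\<nu>)"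
      by (auto intro!: nn_integral_cong nn_integral_monotone_convergence_SUP inc1 simp: measurable_kernel)
    then show ?case
      using inc2 by (simp add: nn_integral_monotone_convergence_SUP seq.IH SUP_apply[abs_def] image_comp)
  qed
  from this[of "case_prod F"] assms show ?thesis by simp
qed

text \<open>Invariance of \<nu>: after the swap of variables the inner integrand is constant, and
  \<open>m x\<close> has mass 1.\<close>

lemma nn_integral_kernel:
  assumes [measurable]: "f \<in> borel_measurable \<nu>"
  shows "(\<integral>\<^sup>+x. \<integral>\<^sup>+y. f y \<partial>m x \<partial>\<nu>) = (\<integral>\<^sup>+x. f x \<partial>\<nu>)"
proof -
  have "(\<integral>\<^sup>+x. \<integral>\<^sup>+y. f y \<partial>m x \<partial>\<nu>) = (\<integral>\<^sup>+x. \<integral>\<^sup>+y. f x \<partial>m x \<partial>\<nu>)"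
    by (rule reversible_nn_integral) measurable
  also have "\<dots> = (\<integral>\<^sup>+x. f x \<partial>\<nu>)"
    by (intro nn_integral_cong) (simp add: prob_space.emeasure_space_1 prob_space_kernel)
  finally show ?thesis .
qed

text \<open>By invariance, m_x(N) has \<nu>-integral \<nu>(N) = 0 for a null set N. This lets
  almost-everywhere conditions, such as the boundary values of a solution, be used under the inner
  integral.\<close>

lemma AE_kernel:
  assumes "AE x in \<nu>. P x"
  shows "AE x in \<nu>. AE y in m x. P y"
proof -
  obtain N where N: "{x \<in> space \<nu>. \<not> P x} \<subseteq> N" "emeasure \<nu> N = 0" "N \<in> sets \<nu>"
    using assms by (auto elim: AE_E)
  note [measurable] = N(3)
  have "(\<integral>\<^sup>+x. \<integral>\<^sup>+y. indicator N y \<partial>m x \<partial>\<nu>) = 0"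
    using N by (simp add: nn_integral_kernel)
  then have "AE x in \<nu>. (\<integral>\<^sup>+y. indicator N y \<partial>m x) = 0"
    by (subst (asm) nn_integral_0_iff_AE) auto
  then show ?thesis
  proof (rule AE_mp[OF _ AE_I2[OF impI]])
    fix x assume x: "x \<in> space \<nu>" "(\<integral>\<^sup>+y. indicator N y \<partial>m x) = 0"
    then have "emeasure (m x) N = 0" using N(3) sets_walk by simp
    then show "AE y in m x. P y"
      using N x sets_walk space_walk by (intro AE_I[of _ _ N]) auto
  qed
qed

text \<open>By invariance the inner integrals of |f| have a finite \<nu>-integral, so they are
  finite almost everywhere.\<close>

lemma AE_integrable_kernel:
  fixes f :: "'a \<Rightarrow> real"
  assumes "integrable \<nu> f"
  shows "AE x in \<nu>. integrable (m x) f"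
proof -
  have [measurable]: "f \<in> borel_measurable \<nu>" using assms by auto
  have "(\<integral>\<^sup>+x. \<integral>\<^sup>+y. ennreal (norm (f y)) \<partial>m x \<partial>\<nu>) \<noteq> \<infinity>"
    using assms by (subst nn_integral_kernel) (auto simp: integrable_iff_bounded)
  then have "AE x in \<nu>. (\<integral>\<^sup>+y. ennreal (norm (f y)) \<partial>m x) \<noteq> \<infinity>"
    by (intro nn_integral_PInf_AE) auto
  then show ?thesis
    by (rule AE_mp) (auto intro!: AE_I2 integrableI_bounded simp: measurable_kernel less_top)
qed

lemma kernel_integral_bounds:
  assumes [measurable]: "g \<in> borel_measurable \<nu>"
    and g: "\<And>x. x \<in> space \<nu> \<Longrightarrow> 0 \<le> g x \<and> g x \<le> (1::real)" and x: "x \<in> space \<nu>"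
  shows "0 \<le> (LINT y|m x. g y)" "(LINT y|m x. g y) \<le> 1" "integrable (m x) g"
proof -
  interpret prob_space "m x" by (rule prob_space_kernel[OF x])
  show i: "integrable (m x) g"
    using g x by (intro integrable_const_bound[of _ 1] AE_I2) (auto simp: measurable_kernel space_walk)
  show "0 \<le> (LINT y|m x. g y)"
    using g x by (intro integral_nonneg_AE AE_I2) (auto simp: space_walk)
  show "(LINT y|m x. g y) \<le> 1"
    using g x i by (intro integral_le_const AE_I2) (auto simp: space_walk)
qed

text \<open>Self-adjointness of the averaging operator, for f merely in L^1 against a bounded g. For
  nonnegative f it is reversibility applied to g(x) f(y); signed f are split into positive and
  negative parts.\<close>

lemma integrable_kernel_times:
  fixes f g :: "'a \<Rightarrow> real"
  assumes f: "integrable \<nu> f" and [measurable]: "g \<in> borel_measurable \<nu>"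
    and g: "\<And>x. x \<in> space \<nu> \<Longrightarrow> 0 \<le> g x \<and> g x \<le> 1"
  shows "integrable \<nu> (\<lambda>x. g x * (LINT y|m x. f y))"
    and "(LINT x|\<nu>. g x * (LINT y|m x. f y)) = (LINT x|\<nu>. f x * (LINT y|m x. g y))"
proof -
  have [measurable]: "(\<lambda>x. LINT y|m x. g y) \<in> borel_measurable \<nu>" by measurable
  have kg: "\<bar>LINT y|m x. g y\<bar> \<le> 1" "0 \<le> (LINT y|m x. g y)" if "x \<in> space \<nu>" for x
    using kernel_integral_bounds[OF assms(2) g that] by auto
  have bounded_mult: "integrable \<nu> (\<lambda>x. h x * (LINT y|m x. g y))" if "integrable \<nu> h" for h :: "'a \<Rightarrow> real"
    using that kg by (intro Bochner_Integration.integrable_bound[OF that] AE_I2)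
      (auto simp: abs_mult intro!: mult_left_le)
  have pos: "integrable \<nu> (\<lambda>x. g x * (LINT y|m x. f y)) \<and>
    (LINT x|\<nu>. g x * (LINT y|m x. f y)) = (LINT x|\<nu>. f x * (LINT y|m x. g y))"
    if f: "integrable \<nu> f" and f0: "\<And>x. 0 \<le> f x" for f
  proof -
    have [measurable]: "f \<in> borel_measurable \<nu>" using f by auto
    have int: "integrable \<nu> (\<lambda>x. f x * (LINT y|m x. g y))"
      using f by (rule bounded_mult)
    have "(\<integral>\<^sup>+x. ennreal (g x * (LINT y|m x. f y)) \<partial>\<nu>) = (\<integral>\<^sup>+x. \<integral>\<^sup>+y. ennreal (g x * f y) \<partial>m x \<partial>\<nu>)"
    proof (rule nn_integral_cong_AE, rule AE_mp[OF AE_integrable_kernel[OF f]], intro AE_I2 impI)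
      fix x assume x: "x \<in> space \<nu>" "integrable (m x) f"
      then have "(\<integral>\<^sup>+y. ennreal (g x * f y) \<partial>m x) = ennreal (LINT y|m x. g x * f y)"
        using g f0 by (intro nn_integral_eq_integral) auto
      then show "ennreal (g x * (LINT y|m x. f y)) = (\<integral>\<^sup>+y. ennreal (g x * f y) \<partial>m x)"
        by simp
    qed
    also have "\<dots> = (\<integral>\<^sup>+x. \<integral>\<^sup>+y. ennreal (g y * f x) \<partial>m x \<partial>\<nu>)"
      by (rule reversible_nn_integral) measurable
    also have "\<dots> = (\<integral>\<^sup>+x. ennreal (f x * (LINT y|m x. g y)) \<partial>\<nu>)"
    proof (rule nn_integral_cong)
      fix x assume x: "x \<in> space \<nu>"
      then have "(\<integral>\<^sup>+y. ennreal (g y * f x) \<partial>m x) = ennreal (LINT y|m x. g y * f x)"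
        using g f0 kernel_integral_bounds(3)[OF assms(2) g x]
        by (intro nn_integral_eq_integral AE_I2) (auto simp: space_walk)
      then show "(\<integral>\<^sup>+y. ennreal (g y * f x) \<partial>m x) = ennreal (f x * (LINT y|m x. g y))"
        by (simp add: mult.commute)
    qed
    also have "\<dots> = ennreal (LINT x|\<nu>. f x * (LINT y|m x. g y))"
      using f0 kg by (intro nn_integral_eq_integral int AE_I2) auto
    finally have "has_bochner_integral \<nu> (\<lambda>x. g x * (LINT y|m x. f y)) (LINT x|\<nu>. f x * (LINT y|m x. g y))"
      using f0 g kg
      by (intro has_bochner_integral_nn_integral AE_I2)
        (auto intro!: mult_nonneg_nonneg integral_nonneg_AE)
    then show ?thesis by (auto simp: has_bochner_integral_iff)
  qed
  have [measurable]: "f \<in> borel_measurable \<nu>" using f by auto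
  let ?p = "\<lambda>x. max 0 (f x)" and ?n = "\<lambda>x. max 0 (- f x)"
  have fp: "integrable \<nu> ?p" and fn: "integrable \<nu> ?n" using f by auto
  have f_eq: "f x = ?p x - ?n x" for x by auto
  \<comment> \<open>On the exceptional null set a nonintegrable inner integral has the default value
    0 and linearity may fail, so the splitting is claimed only almost everywhere.\<close>
  have ae: "AE x in \<nu>. g x * (LINT y|m x. ?p y) - g x * (LINT y|m x. ?n y) = g x * (LINT y|m x. f y)"
    using AE_integrable_kernel[OF fp] AE_integrable_kernel[OF fn]
  proof eventually_elim
    case (elim x)
    have "(LINT y|m x. ?p y) - (LINT y|m x. ?n y) = (LINT y|m x. ?p y - ?n y)"
      using elim by simp
    also have "\<dots> = (LINT y|m x. f y)" by (simp only: f_eq[symmetric])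
    finally show ?case by (simp add: right_diff_distrib[symmetric])
  qed
  have int: "integrable \<nu> (\<lambda>x. g x * (LINT y|m x. ?p y) - g x * (LINT y|m x. ?n y))"
    using pos[OF fp] pos[OF fn] by auto
  show "integrable \<nu> (\<lambda>x. g x * (LINT y|m x. f y))"
    using int ae by (subst (asm) integrable_cong_AE) auto
  have kp: "integrable \<nu> (\<lambda>x. ?p x * (LINT y|m x. g y))" "integrable \<nu> (\<lambda>x. ?n x * (LINT y|m x. g y))"
    using fp fn by (auto intro: bounded_mult)
  have "(LINT x|\<nu>. g x * (LINT y|m x. f y)) = (LINT x|\<nu>. g x * (LINT y|m x. ?p y) - g x * (LINT y|m x. ?n y))"
    using ae by (intro integral_cong_AE) auto
  also have "\<dots> = (LINT x|\<nu>. ?p x * (LINT y|m x. g y)) - (LINT x|\<nu>. ?n x * (LINT y|m x. g y))"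
    using pos[OF fp] pos[OF fn] by simp
  also have "\<dots> = (LINT x|\<nu>. ?p x * (LINT y|m x. g y) - ?n x * (LINT y|m x. g y))"
    using kp by simp
  also have "\<dots> = (LINT x|\<nu>. f x * (LINT y|m x. g y))"
    by (intro Bochner_Integration.integral_cong) (auto simp: left_diff_distrib[symmetric] f_eq[symmetric])
  finally show "(LINT x|\<nu>. g x * (LINT y|m x. f y)) = (LINT x|\<nu>. f x * (LINT y|m x. g y))" .
qed

end

section \<open>The walk killed outside a domain\<close>

lemma measurable_m_boundary:
  assumes "m \<in> measurable \<nu> (prob_algebra \<nu>)" "\<Omega> \<in> sets \<nu>"
  shows "m_boundary \<nu> m \<Omega> \<in> sets \<nu>"
proof -
  have [measurable]: "(\<lambda>x. emeasure (m x) \<Omega>) \<in> borel_measurable \<nu>"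
    using assms by (intro measurable_emeasure_kernel measurable_prob_algebraD)
  note assms(2) [measurable]
  show ?thesis unfolding m_boundary_def by measurable
qed

locale killed_walk = reversible_walk +
  fixes \<Omega>
  assumes domain [measurable]: "\<Omega> \<in> sets \<nu>"
    and finite_domain: "emeasure \<nu> \<Omega> < \<infinity>"
begin

abbreviation "closure_domain \<equiv> m_closure \<nu> m \<Omega>"
abbreviation "g \<equiv> g_seq \<nu> m \<Omega>"
abbreviation "k \<equiv> iterated_kernel m \<Omega>"

text \<open>For a walk started at x, the probability of lying in \<Omega> at all times 0, ..., n;
  \<open>k n\<close> leaves the starting point free. The cut-off turns set integrals into integrals
  over the whole space and makes the function vanish on the boundary, as a Poincare test function
  must.\<close>

definition survival :: "nat \<Rightarrow> 'a \<Rightarrow> real" where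
  "survival n x = indicator \<Omega> x * k n x"

lemma measurable_closure_domain [measurable]: "closure_domain \<in> sets \<nu>"
  unfolding m_closure_def using measurable_m_boundary[OF kernel domain] by auto

lemma iterated_kernel_Suc: "k (Suc n) x = (LINT y|m x. survival n y)"
  by (simp add: set_lebesgue_integral_def survival_def)

lemma measurable_iterated_kernel [measurable]: "k n \<in> borel_measurable \<nu>"
proof (induction n)
  case (Suc n)
  note [measurable] = Suc
  have "survival n \<in> borel_measurable \<nu>" unfolding survival_def[abs_def] by measurable
  then show ?case unfolding iterated_kernel_Suc[abs_def] by measurable
qed simp

lemma measurable_survival [measurable]: "survival n \<in> borel_measurable \<nu>"
  unfolding survival_def[abs_def] by measurable

lemma iterated_kernel_bounds: "x \<in> space \<nu> \<Longrightarrow> 0 \<le> k n x \<and> k n x \<le> 1"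
proof (induction n arbitrary: x)
  case (Suc n)
  have *: "0 \<le> survival n y \<and> survival n y \<le> 1" if "y \<in> space \<nu>" for y
    using Suc.IH[OF that] by (auto simp: survival_def split: split_indicator)
  show ?case
    unfolding iterated_kernel_Suc
    using kernel_integral_bounds(1,2)[OF measurable_survival * Suc.prems] by blast
qed simp

lemma survival_bounds: "x \<in> space \<nu> \<Longrightarrow> 0 \<le> survival n x \<and> survival n x \<le> 1"
  using iterated_kernel_bounds[of x n] by (auto simp: survival_def split: split_indicator)

lemma integrable_kernel_survival:
  assumes "x \<in> space \<nu>"
  shows "integrable (m x) (survival n)"
  by (rule kernel_integral_bounds(3)[OF measurable_survival survival_bounds assms])

lemma survival_le_indicator: "x \<in> space \<nu> \<Longrightarrow> survival n x \<le> indicator \<Omega> x"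
  using iterated_kernel_bounds[of x n] by (auto simp: survival_def split: split_indicator)

lemma integrable_indicator_domain: "integrable \<nu> (indicator \<Omega> :: 'a \<Rightarrow> real)"
  using finite_domain by (simp add: integrable_indicator_iff domain)

lemma integrable_domain_bounded:
  fixes f :: "'a \<Rightarrow> real"
  assumes "f \<in> borel_measurable \<nu>" "\<And>x. x \<in> space \<nu> \<Longrightarrow> \<bar>f x\<bar> \<le> B * indicator \<Omega> x"
  shows "integrable \<nu> f"
proof (rule Bochner_Integration.integrable_bound)
  show "integrable \<nu> (\<lambda>x. B * indicator \<Omega> x :: real)"
    using integrable_indicator_domain by simp
  show "AE x in \<nu>. norm (f x) \<le> norm (B * indicator \<Omega> x)"
    using assms(2) by (intro AE_I2) (auto intro: order_trans[OF _ abs_ge_self])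
qed fact

lemma integrable_survival: "integrable \<nu> (survival n)"
  using survival_bounds[of _ n] survival_le_indicator[of _ n]
  by (intro integrable_domain_bounded[of _ 1]) auto

lemma g_eq: "g n = (LINT x|\<nu>. survival n x)"
  by (simp add: g_seq_def set_lebesgue_integral_def survival_def)

text \<open>Self-adjointness moves one step of the walk from the left factor to the right, so only
  the total number of steps matters. The induction leaves \<open>b\<close> free because it grows as
  \<open>a\<close> shrinks.\<close>

lemma survival_times_iterated_kernel:
  "(LINT x|\<nu>. survival a x * k b x) = g (a + b)"
proof (induction a arbitrary: b)
  case 0
  show ?case by (simp add: g_eq survival_def)
next
  case (Suc a)
  \<comment> \<open>The indicator of \<Omega> changes factor, which puts the integral in the form
    required by self-adjointness.\<close>
  have "(LINT x|\<nu>. survival (Suc a) x * k b x) = (LINT x|\<nu>. survival b x * (LINT y|m x. survival a y))"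
    by (intro Bochner_Integration.integral_cong refl) (simp add: survival_def iterated_kernel_Suc del: iterated_kernel.simps)
  also have "\<dots> = (LINT x|\<nu>. survival a x * (LINT y|m x. survival b y))"
    using survival_bounds by (intro integrable_kernel_times(2) integrable_survival) auto
  also have "\<dots> = (LINT x|\<nu>. survival a x * k (Suc b) x)"
    by (simp only: iterated_kernel_Suc)
  also have "\<dots> = g (Suc a + b)" by (simp add: Suc del: iterated_kernel.simps)
  finally show ?case .
qed

text \<open>The start is k_1 \<le> 1 = k_0, and averaging preserves the order.\<close>

lemma iterated_kernel_decreasing: "x \<in> space \<nu> \<Longrightarrow> k (Suc n) x \<le> k n x"
proof (induction n arbitrary: x)
  case 0
  then show ?case using iterated_kernel_bounds[of x "Suc 0"] by simp
next
  case (Suc n)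
  have "(LINT y|m x. survival (Suc n) y) \<le> (LINT y|m x. survival n y)"
  proof (rule integral_mono)
    show "integrable (m x) (survival (Suc n))" "integrable (m x) (survival n)"
      by (rule integrable_kernel_survival[OF Suc.prems])+
    show "survival (Suc n) y \<le> survival n y" if "y \<in> space (m x)" for y
    proof -
      have "k (Suc n) y \<le> k n y"
        using that Suc.prems by (intro Suc.IH) (simp add: space_walk)
      then show ?thesis
        unfolding survival_def by (intro mult_left_mono) auto
    qed
  qed
  then show ?case by (simp only: iterated_kernel_Suc)
qed

lemma g_nonneg: "0 \<le> g n"
  unfolding g_eq by (rule integral_nonneg_AE) (simp add: survival_bounds)

lemma g_Suc_le: "g (Suc n) \<le> g n"
  unfolding g_eq
proof (rule integral_mono[OF integrable_survival integrable_survival])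
  fix x assume "x \<in> space \<nu>"
  from iterated_kernel_decreasing[OF this, of n]
  show "survival (Suc n) x \<le> survival n x"
    unfolding survival_def by (rule mult_left_mono) simp
qed

lemma g_le: "g n \<le> g 0"
  by (rule lift_Suc_antimono_le[of g, OF g_Suc_le]) simp

lemma L2_on_domain_bounded:
  assumes [measurable]: "f \<in> borel_measurable \<nu>"
    and f: "\<And>x. x \<in> space \<nu> \<Longrightarrow> \<bar>f x\<bar> \<le> indicator \<Omega> x"
  shows "L2_on \<nu> closure_domain f"
proof -
  have "\<bar>indicator closure_domain x * (f x)\<^sup>2\<bar> \<le> 1 * indicator \<Omega> x" if "x \<in> space \<nu>" for x
  proof (cases "x \<in> \<Omega>")
    case True
    then have "(f x)\<^sup>2 \<le> 1" using f[OF that] by (simp add: abs_square_le_1)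
    then show ?thesis using True by (simp add: indicator_def)
  next
    case False
    then show ?thesis using f[OF that] by simp
  qed
  then have "integrable \<nu> (\<lambda>x. indicator closure_domain x * (f x)\<^sup>2)"
    by (intro integrable_domain_bounded[of _ 1]) auto
  then show ?thesis
    by (simp add: L2_on_def set_borel_measurable_def set_integrable_def)
qed

section \<open>Geometric decay from the Poincare inequality\<close>

text \<open>The test function is f = \<open>survival n\<close>. Its squared norm is g(2n), and its
  energy over the whole space is twice the squared norm minus twice the integral of f(x) f(y), that
  is 2 g(2n) - 2 g(2n + 1).\<close>

lemma poincare_decay_step:
  assumes "poincare2 \<nu> m \<Omega>"
  obtains l where "l > 0" "\<And>n. l * g (2 * n) + 2 * g (2 * n + 1) \<le> 2 * g (2 * n)"
proof -
  obtain l where l: "l > 0" and P: "\<And>f. L2_on \<nu> closure_domain f \<Longrightarrow>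
      (AE x\<in>m_boundary \<nu> m \<Omega> in \<nu>. f x = 0) \<Longrightarrow>
      ennreal l * L2_norm_sq \<nu> \<Omega> f \<le> (\<integral>\<^sup>+x\<in>closure_domain.
           (\<integral>\<^sup>+y\<in>closure_domain. ennreal (\<bar>f y - f x\<bar>\<^sup>2) \<partial>m x) \<partial>\<nu>)"
    using assms unfolding poincare2_def by blast
  have "l * g (2 * n) + 2 * g (2 * n + 1) \<le> 2 * g (2 * n)" for n
  proof -
    let ?f = "survival n"
    let ?E = "\<integral>\<^sup>+x. \<integral>\<^sup>+y. ennreal ((?f y - ?f x)\<^sup>2) \<partial>m x \<partial>\<nu>"
    let ?I = "\<integral>\<^sup>+x. \<integral>\<^sup>+y. ennreal (?f x * ?f y) \<partial>m x \<partial>\<nu>"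
    let ?N = "\<integral>\<^sup>+x. ennreal ((?f x)\<^sup>2) \<partial>\<nu>"
    have f: "0 \<le> ?f x" "?f x \<le> 1" "?f x \<le> indicator \<Omega> x" if "x \<in> space \<nu>" for x
      using survival_bounds survival_le_indicator that by auto
    have N: "?N = ennreal (g (2 * n))"
    proof -
      \<comment> \<open>The indicator is idempotent, so one of the two factors may be left
        uncut.\<close>
      have eq: "(?f x)\<^sup>2 = survival n x * k n x" for x
        by (auto simp: survival_def power2_eq_square split: split_indicator)
      have "?N = ennreal (LINT x|\<nu>. (?f x)\<^sup>2)"
      proof (intro nn_integral_eq_integral integrable_domain_bounded[of _ 1])
        show "\<bar>(?f x)\<^sup>2\<bar> \<le> 1 * indicator \<Omega> x" if "x \<in> space \<nu>" for x
          using f[OF that] by (auto split: split_indicator_asm simp: abs_square_le_1 power_le_one)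
      qed auto
      then show ?thesis
        unfolding eq survival_times_iterated_kernel by (simp add: mult_2)
    qed
    have I: "?I = ennreal (g (2 * n + 1))"
    proof -
      have "?I = (\<integral>\<^sup>+x. ennreal (?f x * k (Suc n) x) \<partial>\<nu>)"
      proof (rule nn_integral_cong)
        fix x assume x: "x \<in> space \<nu>"
        have "(\<integral>\<^sup>+y. ennreal (?f x * ?f y) \<partial>m x) = ennreal (LINT y|m x. ?f x * ?f y)"
          using integrable_kernel_survival[OF x] f x
          by (intro nn_integral_eq_integral AE_I2) (auto simp: space_walk)
        then show "(\<integral>\<^sup>+y. ennreal (?f x * ?f y) \<partial>m x) = ennreal (?f x * k (Suc n) x)"
          by (simp add: iterated_kernel_Suc del: iterated_kernel.simps)
      qed
      also have "\<dots> = ennreal (LINT x|\<nu>. ?f x * k (Suc n) x)"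
      proof (intro nn_integral_eq_integral integrable_domain_bounded[of _ 1] AE_I2)
        show "\<bar>?f x * k (Suc n) x\<bar> \<le> 1 * indicator \<Omega> x" "0 \<le> ?f x * k (Suc n) x" if "x \<in> space \<nu>" for x
          using f[OF that] iterated_kernel_bounds[OF that, of "Suc n"]
          by (auto simp: abs_mult intro: order_trans[OF mult_left_le] simp del: iterated_kernel.simps)
      qed measurable
      finally show ?thesis
        unfolding survival_times_iterated_kernel by (simp add: mult_2)
    qed
    have "AE x\<in>m_boundary \<nu> m \<Omega> in \<nu>. ?f x = 0"
      by (auto simp: m_boundary_def survival_def)
    moreover have "L2_on \<nu> closure_domain ?f"
      using f by (intro L2_on_domain_bounded) auto
    ultimately have "ennreal l * L2_norm_sq \<nu> \<Omega> ?f \<le> (\<integral>\<^sup>+x\<in>closure_domain.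
           (\<integral>\<^sup>+y\<in>closure_domain. ennreal (\<bar>?f y - ?f x\<bar>\<^sup>2) \<partial>m x) \<partial>\<nu>)"
      by (intro P)
    \<comment> \<open>The integrand is nonnegative, so dropping both restrictions to the closure
      only enlarges the energy.\<close>
    also have "\<dots> \<le> ?E"
    proof (rule nn_integral_mono)
      fix x
      have "(\<integral>\<^sup>+y\<in>closure_domain. ennreal (\<bar>?f y - ?f x\<bar>\<^sup>2) \<partial>m x) \<le> (\<integral>\<^sup>+y. ennreal ((?f y - ?f x)\<^sup>2) \<partial>m x)"
        by (rule nn_integral_mono) (simp split: split_indicator)
      then show "(\<integral>\<^sup>+y\<in>closure_domain. ennreal (\<bar>?f y - ?f x\<bar>\<^sup>2) \<partial>m x) * indicator closure_domain x
          \<le> (\<integral>\<^sup>+y. ennreal ((?f y - ?f x)\<^sup>2) \<partial>m x)"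
        by (simp split: split_indicator)
    qed
    also have "L2_norm_sq \<nu> \<Omega> ?f = ?N"
      unfolding L2_norm_sq_def
      by (intro nn_integral_cong) (auto simp: survival_def split: split_indicator)
    finally have *: "ennreal l * ?N \<le> ?E" .
    \<comment> \<open>Expansion of the square, stated as a sum because subtraction in
      \<open>ennreal\<close> is truncated.\<close>
    have E2: "?E + 2 * ?I = 2 * ?N"
    proof -
      have "?E + 2 * ?I = (\<integral>\<^sup>+x. (\<integral>\<^sup>+y. ennreal ((?f y - ?f x)\<^sup>2) \<partial>m x) + 2 * (\<integral>\<^sup>+y. ennreal (?f x * ?f y) \<partial>m x) \<partial>\<nu>)"
        by (simp add: nn_integral_add nn_integral_cmult)
      also have "\<dots> = (\<integral>\<^sup>+x. (\<integral>\<^sup>+y. ennreal ((?f x)\<^sup>2) \<partial>m x) + (\<integral>\<^sup>+y. ennreal ((?f y)\<^sup>2) \<partial>m x) \<partial>\<nu>)"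
      proof (rule nn_integral_cong)
        fix x assume x: "x \<in> space \<nu>"
        have "(\<integral>\<^sup>+y. ennreal ((?f y - ?f x)\<^sup>2) \<partial>m x) + 2 * (\<integral>\<^sup>+y. ennreal (?f x * ?f y) \<partial>m x)
          = (\<integral>\<^sup>+y. ennreal ((?f y - ?f x)\<^sup>2) + 2 * ennreal (?f x * ?f y) \<partial>m x)"
          using x by (simp add: nn_integral_add nn_integral_cmult measurable_kernel)
        also have "\<dots> = (\<integral>\<^sup>+y. ennreal ((?f x)\<^sup>2) + ennreal ((?f y)\<^sup>2) \<partial>m x)"
        proof (rule nn_integral_cong)
          fix y assume y: "y \<in> space (m x)"
          have "ennreal ((?f y - ?f x)\<^sup>2) + 2 * ennreal (?f x * ?f y) = ennreal ((?f y - ?f x)\<^sup>2 + 2 * (?f x * ?f y))"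
            using f x y by (simp add: space_walk ennreal_mult')
          also have "(?f y - ?f x)\<^sup>2 + 2 * (?f x * ?f y) = (?f x)\<^sup>2 + (?f y)\<^sup>2"
            by (simp add: power2_eq_square algebra_simps)
          finally show "ennreal ((?f y - ?f x)\<^sup>2) + 2 * ennreal (?f x * ?f y) = ennreal ((?f x)\<^sup>2) + ennreal ((?f y)\<^sup>2)"
            by simp
        qed
        also have "\<dots> = (\<integral>\<^sup>+y. ennreal ((?f x)\<^sup>2) \<partial>m x) + (\<integral>\<^sup>+y. ennreal ((?f y)\<^sup>2) \<partial>m x)"
          using x by (intro nn_integral_add) (auto simp: measurable_kernel)
        finally show "(\<integral>\<^sup>+y. ennreal ((?f y - ?f x)\<^sup>2) \<partial>m x) + 2 * (\<integral>\<^sup>+y. ennreal (?f x * ?f y) \<partial>m x)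
          = (\<integral>\<^sup>+y. ennreal ((?f x)\<^sup>2) \<partial>m x) + (\<integral>\<^sup>+y. ennreal ((?f y)\<^sup>2) \<partial>m x)" .
      qed
      also have "\<dots> = (\<integral>\<^sup>+x. \<integral>\<^sup>+y. ennreal ((?f x)\<^sup>2) \<partial>m x \<partial>\<nu>) + (\<integral>\<^sup>+x. \<integral>\<^sup>+y. ennreal ((?f y)\<^sup>2) \<partial>m x \<partial>\<nu>)"
        by (intro nn_integral_add) measurable
      \<comment> \<open>Both squares contribute \<open>?N\<close>: the one in x becomes the one in y
        by reversibility, and that one is evaluated by invariance.\<close>
      also have "(\<integral>\<^sup>+x. \<integral>\<^sup>+y. ennreal ((?f x)\<^sup>2) \<partial>m x \<partial>\<nu>) = (\<integral>\<^sup>+x. \<integral>\<^sup>+y. ennreal ((?f y)\<^sup>2) \<partial>m x \<partial>\<nu>)"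
        by (rule reversible_nn_integral) measurable
      also have "(\<integral>\<^sup>+x. \<integral>\<^sup>+y. ennreal ((?f y)\<^sup>2) \<partial>m x \<partial>\<nu>) = ?N"
        by (rule nn_integral_kernel) measurable
      finally show ?thesis by (simp add: mult_2)
    qed
    have "ennreal l * ?N + 2 * ?I \<le> 2 * ?N"
      using add_right_mono[OF *, of "2 * ?I"] E2 by simp
    then have "ennreal (l * g (2 * n) + 2 * g (2 * n + 1)) \<le> ennreal (2 * g (2 * n))"
      unfolding N I using l g_nonneg by (simp add: ennreal_mult')
    then show ?thesis using g_nonneg by (simp add: ennreal_le_iff)
  qed
  with l that show ?thesis by blast
qed

text \<open>The Poincare step gains a factor q from 2n to 2n + 1, and monotonicity carries it to 2n
  + 2. Thus q is gained every two steps, which makes sqrt q the rate per step.\<close>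

lemma g_geometric_decay:
  assumes "poincare2 \<nu> m \<Omega>"
  obtains r C where "0 < r" "r < 1" "\<And>n. g n \<le> C * r ^ n"
proof -
  obtain l where l: "l > 0" and step: "\<And>n. l * g (2 * n) + 2 * g (2 * n + 1) \<le> 2 * g (2 * n)"
    using poincare_decay_step[OF assms] by blast
  \<comment> \<open>The maximum with 1/4 only keeps the ratio positive, in case \<open>l\<close> is 2 or more.\<close>
  define q where "q = max (1 - l / 2) (1 / 4)"
  define r where "r = sqrt q"
  have q: "0 < q" "q < 1" "1 - l / 2 \<le> q" using l by (auto simp: q_def)
  have r: "0 < r" "r < 1" "r\<^sup>2 = q" using q by (auto simp: r_def)
  have step': "g (2 * n + 1) \<le> q * g (2 * n)" for n
  proof -
    have "g (2 * n + 1) \<le> (1 - l / 2) * g (2 * n)" using step[of n] by (simp add: algebra_simps)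
    also have "\<dots> \<le> q * g (2 * n)" using q g_nonneg by (intro mult_right_mono)
    finally show ?thesis .
  qed
  have even: "g (2 * n) \<le> g 0 * r ^ (2 * n)" for n
  proof (induction n)
    case (Suc n)
    have "g (2 * Suc n) \<le> g (2 * n + 1)" using g_Suc_le[of "2 * n + 1"] by simp
    also have "\<dots> \<le> q * g (2 * n)" by (rule step')
    also have "\<dots> \<le> q * (g 0 * r ^ (2 * n))" using Suc q by (intro mult_left_mono) auto
    finally show ?case by (simp add: r(3)[symmetric] power2_eq_square mult_ac)
  qed simp
  \<comment> \<open>At n = 2i + 1 only the bound for 2i is available; dividing the constant by r
    pays for the missing factor.\<close>
  have "g n \<le> (g 0 / r) * r ^ n" for n
  proof (cases "even n")
    case True
    then obtain i where "n = 2 * i" by blast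
    moreover have "g 0 * r ^ n \<le> (g 0 / r) * r ^ n"
      using r g_nonneg[of 0] by (intro mult_right_mono) (auto simp: field_simps mult_left_le_one_le)
    ultimately show ?thesis using even[of i] by simp
  next
    case False
    then obtain i where "n = 2 * i + 1" by (auto elim: oddE)
    then show ?thesis using g_Suc_le[of "2 * i"] even[of i] r by simp
  qed
  with r that show ?thesis by blast
qed

section \<open>The Dirichlet heat flow\<close>

text \<open>A point y outside the closure has m_y(\<Omega>) = 0. By reversibility the flow from
  \<Omega> to such points equals the flow back, hence vanishes.\<close>

lemma AE_kernel_closure_domain:
  "AE x in \<nu>. x \<in> \<Omega> \<longrightarrow> (AE y in m x. y \<in> closure_domain)"
proof -
  let ?S = "space \<nu> - closure_domain"
  have "(\<integral>\<^sup>+x. \<integral>\<^sup>+y. indicator \<Omega> x * indicator ?S y \<partial>m x \<partial>\<nu>)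
      = (\<integral>\<^sup>+x. \<integral>\<^sup>+y. indicator \<Omega> y * indicator ?S x \<partial>m x \<partial>\<nu>)"
    by (rule reversible_nn_integral) measurable
  also have "\<dots> = (\<integral>\<^sup>+x. 0 \<partial>\<nu>)"
  proof (rule nn_integral_cong)
    fix x assume x: "x \<in> space \<nu>"
    have "emeasure (m x) \<Omega> = 0" if "x \<in> ?S"
      using that by (auto simp: m_closure_def m_boundary_def)
    then show "(\<integral>\<^sup>+y. indicator \<Omega> y * indicator ?S x \<partial>m x) = 0"
      using x domain sets_walk[OF x] by (simp split: split_indicator)
  qed
  finally have "(\<integral>\<^sup>+x. \<integral>\<^sup>+y. indicator \<Omega> x * indicator ?S y \<partial>m x \<partial>\<nu>) = 0" by simp
  then have "AE x in \<nu>. (\<integral>\<^sup>+y. indicator \<Omega> x * indicator ?S y \<partial>m x) = 0"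
    by (subst (asm) nn_integral_0_iff_AE) auto
  then show ?thesis
  proof (rule AE_mp[OF _ AE_I2[OF impI]], intro impI)
    fix x assume x: "x \<in> space \<nu>" "x \<in> \<Omega>"
      and 0: "(\<integral>\<^sup>+y. indicator \<Omega> x * indicator ?S y \<partial>m x) = 0"
    have "?S \<in> sets (m x)" using sets_walk[OF x(1)] measurable_closure_domain by auto
    with 0 x show "AE y in m x. y \<in> closure_domain"
      using space_walk[OF x(1)] by (intro AE_I[of _ _ ?S]) auto
  qed
qed

text \<open>On a set of finite measure L^2 is contained in L^1, here through |a| \<le> 1 +
  a^2.\<close>

lemma integrable_L2_on:
  assumes "L2_on \<nu> closure_domain f"
  shows "integrable \<nu> (\<lambda>x. indicator \<Omega> x * f x)"
proof -
  have [measurable]: "(\<lambda>x. indicator closure_domain x * f x) \<in> borel_measurable \<nu>"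
    and int: "integrable \<nu> (\<lambda>x. indicator closure_domain x * (f x)\<^sup>2)"
    using assms by (auto simp: L2_on_def set_borel_measurable_def set_integrable_def)
  have sub: "\<Omega> \<subseteq> closure_domain" by (simp add: m_closure_def)
  \<comment> \<open>\<open>L2_on\<close> gives measurability of f cut off to the closure only; f is
    arbitrary elsewhere.\<close>
  then have eq: "(\<lambda>x. indicator \<Omega> x * f x) = (\<lambda>x. indicator \<Omega> x * (indicator closure_domain x * f x))"
    by (auto simp: fun_eq_iff split: split_indicator)
  have meas: "(\<lambda>x. indicator \<Omega> x * f x) \<in> borel_measurable \<nu>"
    unfolding eq by measurable
  show "integrable \<nu> (\<lambda>x. indicator \<Omega> x * f x)"
  proof (rule Bochner_Integration.integrable_bound[OF _ meas])
    show "integrable \<nu> (\<lambda>x. indicator \<Omega> x + indicator closure_domain x * (f x)\<^sup>2)"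
      using int integrable_indicator_domain by simp
    \<comment> \<open>From (|a| - 1/2)^2 \<ge> 0 follows |a| \<le> a^2 + 1/4.\<close>
    have le: "\<bar>a\<bar> \<le> 1 + a\<^sup>2" for a :: real
      using sum_power2_ge_zero[of "\<bar>a\<bar> - 1/2" 0] by (simp add: power2_eq_square algebra_simps)
    show "AE x in \<nu>. norm (indicator \<Omega> x * f x) \<le> norm (indicator \<Omega> x + indicator closure_domain x * (f x)\<^sup>2)"
    proof (rule AE_I2)
      fix x
      show "norm (indicator \<Omega> x * f x) \<le> norm (indicator \<Omega> x + indicator closure_domain x * (f x)\<^sup>2)"
        using le[of "f x"] sub by (cases "x \<in> \<Omega>") (auto simp: indicator_def)
    qed
  qed
qed

text \<open>Started in \<Omega>, the walk stays in the closure for one step, so f(x) is weighted by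
  mass 1; the boundary adds nothing because f vanishes there. This is the form K f - f of the
  right-hand side.\<close>

lemma AE_laplacian_eq:
  assumes f: "L2_on \<nu> closure_domain f" and f0: "AE x\<in>m_boundary \<nu> m \<Omega> in \<nu>. f x = 0"
  shows "AE x in \<nu>. x \<in> \<Omega> \<longrightarrow> (LINT y:closure_domain|m x. f y - f x)
     = (LINT y|m x. indicator \<Omega> y * f y) - f x"
  using AE_kernel_closure_domain AE_kernel[OF f0] AE_integrable_kernel[OF integrable_L2_on[OF f]] AE_space
proof eventually_elim
  case (elim x)
  show ?case
  proof
    assume x: "x \<in> \<Omega>"
    interpret prob_space "m x" by (rule prob_space_kernel) fact
    have [measurable]: "(\<lambda>y. indicator closure_domain y * f y) \<in> borel_measurable (m x)"
      using f elim(4) by (simp add: L2_on_def set_borel_measurable_def measurable_kernel)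
    have [measurable]: "closure_domain \<in> sets (m x)" "\<Omega> \<in> sets (m x)"
      using sets_walk[OF elim(4)] measurable_closure_domain domain by auto
    have [measurable]: "(\<lambda>y. indicator \<Omega> y * f y) \<in> borel_measurable (m x)"
      using elim(3) by auto
    have "(LINT y:closure_domain|m x. f y - f x)
        = (LINT y|m x. indicator closure_domain y * f y - indicator closure_domain y * f x)"
      by (simp add: set_lebesgue_integral_def right_diff_distrib)
    also have "\<dots> = (LINT y|m x. indicator \<Omega> y * f y - f x)"
    proof (rule integral_cong_AE)
      show "AE y in m x. indicator closure_domain y * f y - indicator closure_domain y * f x = indicator \<Omega> y * f y - f x"
        using elim(1)[rule_format, OF x] elim(2)
        by eventually_elim (auto simp: m_closure_def indicator_def)
    qed measurable
    also have "\<dots> = (LINT y|m x. indicator \<Omega> y * f y) - f x"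
      using elim(3) by (simp add: prob_space)
    finally show "(LINT y:closure_domain|m x. f y - f x) = (LINT y|m x. indicator \<Omega> y * f y) - f x" .
  qed
qed

text \<open>Cauchy-Schwarz against the indicator of \<Omega>, whose measure is finite. Convergence
  in L^1 is enough later, since the functions k_n are bounded by 1.\<close>

lemma L2_limit_imp_L1_limit:
  fixes f :: "'b \<Rightarrow> 'a \<Rightarrow> real"
  assumes lim: "((\<lambda>h. L2_norm_sq \<nu> \<Omega> (f h)) \<longlongrightarrow> 0) F"
    and meas: "eventually (\<lambda>h. (\<lambda>x. indicator \<Omega> x * f h x) \<in> borel_measurable \<nu>) F"
  shows "((\<lambda>h. LINT x|\<nu>. \<bar>indicator \<Omega> x * f h x\<bar>) \<longlongrightarrow> 0) F"
proof -
  define X where "X h = (\<integral>\<^sup>+x. ennreal \<bar>indicator \<Omega> x * f h x\<bar> \<partial>\<nu>)" for h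
  have "eventually (\<lambda>h. (X h)\<^sup>2 \<le> L2_norm_sq \<nu> \<Omega> (f h) * emeasure \<nu> \<Omega>) F"
    using meas
  proof eventually_elim
    case (elim h)
    note [measurable] = elim
    have "X h = (\<integral>\<^sup>+x. ennreal \<bar>indicator \<Omega> x * f h x\<bar> * indicator \<Omega> x \<partial>\<nu>)"
      unfolding X_def by (intro nn_integral_cong) (simp split: split_indicator)
    also have "\<dots>\<^sup>2 \<le> (\<integral>\<^sup>+x. (ennreal \<bar>indicator \<Omega> x * f h x\<bar>)\<^sup>2 \<partial>\<nu>) * (\<integral>\<^sup>+x. (indicator \<Omega> x)\<^sup>2 \<partial>\<nu>)"
      by (rule Cauchy_Schwarz_nn_integral) measurable
    also have "(\<integral>\<^sup>+x. (ennreal \<bar>indicator \<Omega> x * f h x\<bar>)\<^sup>2 \<partial>\<nu>) = L2_norm_sq \<nu> \<Omega> (f h)"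
      unfolding L2_norm_sq_def
      by (intro nn_integral_cong) (simp add: ennreal_power split: split_indicator)
    also have "(\<integral>\<^sup>+x. (indicator \<Omega> x)\<^sup>2 \<partial>\<nu>) = (\<integral>\<^sup>+x. indicator \<Omega> x \<partial>\<nu>)"
      by (intro nn_integral_cong) (simp split: split_indicator)
    finally show ?case by simp
  qed
  moreover have "((\<lambda>h. L2_norm_sq \<nu> \<Omega> (f h) * emeasure \<nu> \<Omega>) \<longlongrightarrow> 0 * emeasure \<nu> \<Omega>) F"
    using finite_domain by (intro tendsto_mult_ennreal lim tendsto_const) auto
  ultimately have "((\<lambda>h. (X h)\<^sup>2) \<longlongrightarrow> 0) F"
    by (simp add: tendsto_sandwich[of "\<lambda>_. 0" _ F "\<lambda>h. L2_norm_sq \<nu> \<Omega> (f h) * emeasure \<nu> \<Omega>"])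
  \<comment> \<open>The square root is taken in the reals; the limit 0 is finite, so the conversion
    preserves it.\<close>
  then have "((\<lambda>h. enn2real ((X h)\<^sup>2)) \<longlongrightarrow> 0) F"
    by (rule tendsto_enn2real[of _ 0, unfolded ennreal_0, OF _ order_refl])
  then have "((\<lambda>h. (enn2real (X h))\<^sup>2) \<longlongrightarrow> 0) F"
    by (simp add: power2_eq_square enn2real_mult)
  then have "((\<lambda>h. sqrt ((enn2real (X h))\<^sup>2)) \<longlongrightarrow> sqrt 0) F"
    by (rule tendsto_real_sqrt)
  then have lim': "((\<lambda>h. enn2real (X h)) \<longlongrightarrow> 0) F" by simp
  have "eventually (\<lambda>h. enn2real (X h) = (LINT x|\<nu>. \<bar>indicator \<Omega> x * f h x\<bar>)) F"
    using meas unfolding X_def by eventually_elim (simp add: integral_eq_nn_integral)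
  from tendsto_cong[OF this] lim' show ?thesis by simp
qed

lemma abs_integral_times_iterated_kernel_le:
  assumes f: "integrable \<nu> f"
  shows "integrable \<nu> (\<lambda>x. f x * k n x)" "\<bar>LINT x|\<nu>. f x * k n x\<bar> \<le> (LINT x|\<nu>. \<bar>f x\<bar>)"
proof -
  have [measurable]: "f \<in> borel_measurable \<nu>" using f by auto
  have le: "\<bar>f x * k n x\<bar> \<le> \<bar>f x\<bar>" if "x \<in> space \<nu>" for x
    using iterated_kernel_bounds[OF that, of n] by (simp add: abs_mult mult_left_le)
  show "integrable \<nu> (\<lambda>x. f x * k n x)"
    by (rule Bochner_Integration.integrable_bound[OF f]) (auto intro!: le)
  then show "\<bar>LINT x|\<nu>. f x * k n x\<bar> \<le> (LINT x|\<nu>. \<bar>f x\<bar>)"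
    using f le by (intro order_trans[OF integral_abs_bound integral_mono] integrable_abs)
qed

text \<open>The solution is arbitrary because the heat content is defined through a choice. Pairing
  with all k_n at once reduces the flow to the scalar system of
  \<open>exp_weighted_unique\<close>.\<close>

lemma heat_solution_content:
  assumes v: "heat_solution \<nu> m \<Omega> v" and "0 \<le> t"
  shows "(LINT x:\<Omega>|\<nu>. v t x) = exp_weighted g t"
proof -
  have L2: "\<And>t. 0 \<le> t \<Longrightarrow> L2_on \<nu> closure_domain (v t)"
    and deriv: "\<And>t. 0 < t \<Longrightarrow> ((\<lambda>h. L2_norm_sq \<nu> \<Omega>
           (\<lambda>x. (v (t + h) x - v t x) / h - (LINT y:closure_domain|m x. v t y - v t x)))
         \<longlongrightarrow> 0) (at 0)"
    and bd: "\<And>t. 0 < t \<Longrightarrow> AE x\<in>m_boundary \<nu> m \<Omega> in \<nu>. v t x = 0"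
    and init: "AE x\<in>\<Omega> in \<nu>. v 0 x = 1"
    and cont0: "((\<lambda>t. L2_norm_sq \<nu> \<Omega> (\<lambda>x. v t x - v 0 x)) \<longlongrightarrow> 0) (at_right 0)"
    using v by (auto simp: heat_solution_def)
  \<comment> \<open>The cut-off \<open>w\<close> is measurable on the whole space. \<open>L\<close>
    is its L^1 norm, which bounds every \<open>a n\<close>; \<open>A\<close> is the generator K w -
    w, and \<open>D\<close> the error of the difference quotient.\<close>
  define w where "w t x = indicator \<Omega> x * v t x" for t x
  have wi: "integrable \<nu> (w t)" if "0 \<le> t" for t
    using integrable_L2_on[OF L2[OF that]] unfolding w_def .
  have wm: "w t \<in> borel_measurable \<nu>" if "0 \<le> t" for t
    using wi[OF that] by auto
  define a where "a n t = (LINT x|\<nu>. w t x * k n x)" for n t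
  define L where "L t = (LINT x|\<nu>. \<bar>w t x\<bar>)" for t
  define A where "A t x = indicator \<Omega> x * (LINT y|m x. w t y) - w t x" for t x
  define D where "D t h x = (w (t + h) x - w t x) / h - A t x" for t h x
  have Ai: "integrable \<nu> (A t)" if "0 \<le> t" for t
    unfolding A_def using wi[OF that]
    by (intro Bochner_Integration.integrable_diff integrable_kernel_times(1)) (auto split: split_indicator)
  have Di: "integrable \<nu> (D t h)" if "0 \<le> t" "0 \<le> t + h" for t h
    unfolding D_def using wi[of "t + h"] wi[of t] Ai[of t] that by auto
  \<comment> \<open>Solutions are controlled at nonnegative times only, so quotients are used for h
    close enough to 0.\<close>
  have near: "eventually (\<lambda>h. h \<noteq> 0 \<and> 0 \<le> t + h) (at 0)" if "0 < t" for t :: real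
  proof -
    have "eventually (\<lambda>h. h \<in> {- t<..}) (at 0)"
      using that by (intro eventually_at_in_open') auto
    moreover have "eventually (\<lambda>h. h \<noteq> 0) (at (0::real))" by (rule eventually_neq_at_within)
    ultimately show ?thesis by eventually_elim auto
  qed
  have D_lim: "((\<lambda>h. LINT x|\<nu>. \<bar>D t h x\<bar>) \<longlongrightarrow> 0) (at 0)" if t: "0 < t" for t
  proof -
    \<comment> \<open>The Laplacian agrees with the generator almost everywhere on \<Omega>, and the
      norm ignores null sets.\<close>
    have "L2_norm_sq \<nu> \<Omega> (\<lambda>x. (v (t + h) x - v t x) / h - (LINT y:closure_domain|m x. v t y - v t x))
        = L2_norm_sq \<nu> \<Omega> (D t h)" for h
      unfolding L2_norm_sq_def
    proof (rule nn_integral_cong_AE)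
      show "AE x in \<nu>. ennreal (((v (t + h) x - v t x) / h - (LINT y:closure_domain|m x. v t y - v t x))\<^sup>2) * indicator \<Omega> x
         = ennreal ((D t h x)\<^sup>2) * indicator \<Omega> x"
        using AE_laplacian_eq[OF L2[OF less_imp_le[OF t]] bd[OF t]]
        by eventually_elim (auto simp: D_def A_def w_def indicator_def)
    qed
    then have "((\<lambda>h. L2_norm_sq \<nu> \<Omega> (D t h)) \<longlongrightarrow> 0) (at 0)"
      using deriv[OF t] by simp
    then have "((\<lambda>h. LINT x|\<nu>. \<bar>indicator \<Omega> x * D t h x\<bar>) \<longlongrightarrow> 0) (at 0)"
    proof (rule L2_limit_imp_L1_limit)
      show "\<forall>\<^sub>F h in at 0. (\<lambda>x. indicator \<Omega> x * D t h x) \<in> borel_measurable \<nu>"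
        using near[OF t]
      proof eventually_elim
        case (elim h)
        have "D t h \<in> borel_measurable \<nu>" using Di[of t h] elim t by auto
        then show ?case by measurable
      qed
    qed
    moreover have "indicator \<Omega> x * D t h x = D t h x" for h x
      by (auto simp: D_def A_def w_def indicator_def)
    ultimately show ?thesis by simp
  qed
  have a_deriv: "(a n has_real_derivative a (Suc n) t - a n t) (at t)" if t: "0 < t" for n t
  proof -
    \<comment> \<open>Self-adjointness moves the averaging from \<open>w t\<close> to
      \<open>k n\<close>, which raises the index by one.\<close>
    have A_eq: "(LINT x|\<nu>. A t x * k n x) = a (Suc n) t - a n t"
    proof -
      have "(LINT x|\<nu>. survival n x * (LINT y|m x. w t y)) = (LINT x|\<nu>. w t x * k (Suc n) x)"
        unfolding iterated_kernel_Suc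
        by (intro integrable_kernel_times(2) wi survival_bounds) (use t in auto)
      moreover have "integrable \<nu> (\<lambda>x. survival n x * (LINT y|m x. w t y))"
        by (intro integrable_kernel_times(1) wi survival_bounds) (use t in auto)
      moreover have "A t x * k n x = survival n x * (LINT y|m x. w t y) - w t x * k n x" for x
        by (simp add: A_def survival_def algebra_simps)
      moreover have "integrable \<nu> (\<lambda>x. w t x * k n x)"
        using t by (intro abs_integral_times_iterated_kernel_le(1) wi) auto
      ultimately show ?thesis by (simp add: a_def del: iterated_kernel.simps)
    qed
    have "((\<lambda>h. (a n (t + h) - a n t) / h - (a (Suc n) t - a n t)) \<longlongrightarrow> 0) (at 0)"
    proof (rule Lim_null_comparison[OF _ D_lim[OF t]])
      show "\<forall>\<^sub>F h in at 0. norm ((a n (t + h) - a n t) / h - (a (Suc n) t - a n t)) \<le> (LINT x|\<nu>. \<bar>D t h x\<bar>)"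
        using near[OF t]
      proof eventually_elim
        case (elim h)
        have i: "integrable \<nu> (\<lambda>x. w (t + h) x * k n x)" "integrable \<nu> (\<lambda>x. w t x * k n x)"
          "integrable \<nu> (\<lambda>x. A t x * k n x)"
          using t elim by (auto intro!: abs_integral_times_iterated_kernel_le(1) wi Ai)
        have "(LINT x|\<nu>. D t h x * k n x)
           = (LINT x|\<nu>. (w (t + h) x * k n x - w t x * k n x) / h - A t x * k n x)"
          by (intro Bochner_Integration.integral_cong refl) (simp add: D_def algebra_simps diff_divide_distrib)
        also have "\<dots> = (a n (t + h) - a n t) / h - (a (Suc n) t - a n t)"
          using i unfolding A_eq[symmetric] by (simp add: a_def)
        finally show ?case
          using abs_integral_times_iterated_kernel_le(2)[OF Di[of t h], of n] t elim by simp
      qed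
    qed
    then show ?thesis
      unfolding DERIV_def by (rule LIM_zero_cancel)
  qed
  have diff_le: "\<bar>a n s - a n t\<bar> \<le> (LINT x|\<nu>. \<bar>w s x - w t x\<bar>)"
    "\<bar>L s - L t\<bar> \<le> (LINT x|\<nu>. \<bar>w s x - w t x\<bar>)" if "0 \<le> s" "0 \<le> t" for s t n
  proof -
    have i: "integrable \<nu> (\<lambda>x. w s x - w t x)" using wi that by auto
    have "(LINT x|\<nu>. (w s x - w t x) * k n x) = a n s - a n t"
      using abs_integral_times_iterated_kernel_le(1)[OF wi, of s n]
        abs_integral_times_iterated_kernel_le(1)[OF wi, of t n] that
      by (simp add: a_def left_diff_distrib)
    then show "\<bar>a n s - a n t\<bar> \<le> (LINT x|\<nu>. \<bar>w s x - w t x\<bar>)"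
      using abs_integral_times_iterated_kernel_le(2)[OF i, of n] by simp
    have "L s - L t = (LINT x|\<nu>. \<bar>w s x\<bar> - \<bar>w t x\<bar>)"
      using wi[of s] wi[of t] that by (simp add: L_def)
    also have "\<bar>\<dots>\<bar> \<le> (LINT x|\<nu>. \<bar>\<bar>w s x\<bar> - \<bar>w t x\<bar>\<bar>)" by (rule integral_abs_bound)
    also have "\<dots> \<le> (LINT x|\<nu>. \<bar>w s x - w t x\<bar>)"
      using wi[of s] wi[of t] that by (intro integral_mono) auto
    finally show "\<bar>L s - L t\<bar> \<le> (LINT x|\<nu>. \<bar>w s x - w t x\<bar>)" .
  qed
  have w_lim0: "((\<lambda>s. LINT x|\<nu>. \<bar>w s x - w 0 x\<bar>) \<longlongrightarrow> 0) (at_right 0)"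
  proof -
    have eq: "indicator \<Omega> x * (v s x - v 0 x) = w s x - w 0 x" for s x
      by (simp add: w_def algebra_simps)
    have pos: "eventually (\<lambda>s. 0 \<le> s) (at_right (0::real))"
      using eventually_at_right_less by (rule eventually_mono) auto
    have "eventually (\<lambda>s. (\<lambda>x. indicator \<Omega> x * (v s x - v 0 x)) \<in> borel_measurable \<nu>) (at_right 0)"
      using pos unfolding eq by eventually_elim (intro borel_measurable_diff wm, auto)
    from L2_limit_imp_L1_limit[OF cont0 this] show ?thesis unfolding eq .
  qed
  \<comment> \<open>Differentiability gives continuity: the increment of w is h (D + A), where D
    tends to 0 in L^1 and A does not depend on h.\<close>
  have w_lim: "((\<lambda>h. LINT x|\<nu>. \<bar>w (t + h) x - w t x\<bar>) \<longlongrightarrow> 0) (at 0)" if t: "0 < t" for t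
  proof (rule Lim_null_comparison)
    show "((\<lambda>h. \<bar>h\<bar> * ((LINT x|\<nu>. \<bar>D t h x\<bar>) + (LINT x|\<nu>. \<bar>A t x\<bar>))) \<longlongrightarrow> 0) (at 0)"
      by (rule tendsto_eq_intros D_lim[OF t] refl | simp)+
    show "\<forall>\<^sub>F h in at 0. norm (LINT x|\<nu>. \<bar>w (t + h) x - w t x\<bar>)
       \<le> \<bar>h\<bar> * ((LINT x|\<nu>. \<bar>D t h x\<bar>) + (LINT x|\<nu>. \<bar>A t x\<bar>))"
      using near[OF t]
    proof eventually_elim
      case (elim h)
      have i: "integrable \<nu> (w (t + h))" "integrable \<nu> (w t)" "integrable \<nu> (D t h)" "integrable \<nu> (A t)"
        using elim t by (auto intro: wi Di Ai)
      have "(LINT x|\<nu>. \<bar>w (t + h) x - w t x\<bar>) \<le> (LINT x|\<nu>. \<bar>h\<bar> * (\<bar>D t h x\<bar> + \<bar>A t x\<bar>))"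
      proof (rule integral_mono)
        fix x
        have "w (t + h) x - w t x = h * (D t h x + A t x)" using elim by (simp add: D_def)
        then show "\<bar>w (t + h) x - w t x\<bar> \<le> \<bar>h\<bar> * (\<bar>D t h x\<bar> + \<bar>A t x\<bar>)"
          by (simp add: abs_mult mult_left_mono)
      qed (use i in auto)
      also have "\<dots> = \<bar>h\<bar> * ((LINT x|\<nu>. \<bar>D t h x\<bar>) + (LINT x|\<nu>. \<bar>A t x\<bar>))"
        using i by simp
      finally show ?case by simp
    qed
  qed
  \<comment> \<open>Continuity makes \<open>L\<close> bounded on compact time intervals, the local
    bound uniform in n that uniqueness asks for.\<close>
  have L_cont: "continuous_on {0..} L"
    unfolding continuous_on_eq_continuous_within
  proof
    fix t :: real assume "t \<in> {0..}"
    show "continuous (at t within {0..}) L"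
    proof (cases "t = 0")
      case True
      have "((\<lambda>s. L s - L 0) \<longlongrightarrow> 0) (at_right 0)"
        by (rule Lim_null_comparison[OF _ w_lim0])
          (use eventually_at_right_less[of 0] in eventually_elim, auto intro!: diff_le(2))
      then show ?thesis
        using True by (simp add: continuous_within at_within_Ici_at_right LIM_zero_cancel)
    next
      case False
      then have t: "0 < t" using \<open>t \<in> {0..}\<close> by auto
      have "((\<lambda>h. L (t + h) - L t) \<longlongrightarrow> 0) (at 0)"
        by (rule Lim_null_comparison[OF _ w_lim[OF t]])
          (use near[OF t] in eventually_elim, use t in \<open>auto intro!: diff_le(2)\<close>)
      then have "isCont L t" unfolding isCont_iff by (rule LIM_zero_cancel)
      then show ?thesis by (rule continuous_at_imp_continuous_at_within)
    qed
  qed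
  have a_lim0: "(a n \<longlongrightarrow> a n 0) (at_right 0)" for n
  proof -
    have "((\<lambda>s. a n s - a n 0) \<longlongrightarrow> 0) (at_right 0)"
      by (rule Lim_null_comparison[OF _ w_lim0])
        (use eventually_at_right_less[of 0] in eventually_elim, auto intro!: diff_le(1))
    then show ?thesis by (rule LIM_zero_cancel)
  qed
  have "a 0 t = exp_weighted (\<lambda>n. a n 0) t"
    by (rule exp_weighted_unique[where a = a and L = L, OF a_deriv a_lim0 _ L_cont \<open>0 \<le> t\<close>])
      (auto simp: a_def L_def intro!: abs_integral_times_iterated_kernel_le(2) wi)
  also have "(\<lambda>n. a n 0) = g"
  proof
    fix n
    have [measurable]: "w 0 \<in> borel_measurable \<nu>" by (rule wm) simp
    have "a n 0 = (LINT x|\<nu>. survival n x)"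
      unfolding a_def
    proof (rule integral_cong_AE)
      show "AE x in \<nu>. w 0 x * k n x = survival n x"
        using init by eventually_elim (auto simp: w_def survival_def indicator_def)
    qed measurable
    then show "a n 0 = g n" by (simp add: g_eq)
  qed
  finally show ?thesis
    by (simp add: a_def w_def set_lebesgue_integral_def)
qed

section \<open>Existence of the flow by an explicit series\<close>

text \<open>The semigroup exp(t (K - 1)) applied to the constant 1, expanded in powers of K and cut
  off to \<Omega>.\<close>

definition dirichlet_heat :: "real \<Rightarrow> 'a \<Rightarrow> real" where
  "dirichlet_heat t x = indicator \<Omega> x * exp_weighted (\<lambda>n. k n x) t"

lemma abs_iterated_kernel_le: "x \<in> space \<nu> \<Longrightarrow> \<bar>k n x\<bar> \<le> 1"
  using iterated_kernel_bounds[of x n] by simp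

lemma measurable_dirichlet_heat [measurable]: "dirichlet_heat t \<in> borel_measurable \<nu>"
  unfolding dirichlet_heat_def[abs_def] exp_weighted_def by measurable

lemma L2_on_dirichlet_heat:
  assumes "0 \<le> t"
  shows "L2_on \<nu> closure_domain (dirichlet_heat t)"
proof (rule L2_on_domain_bounded)
  fix x assume "x \<in> space \<nu>"
  from abs_exp_weighted_le[OF abs_iterated_kernel_le[OF this] assms]
  show "\<bar>dirichlet_heat t x\<bar> \<le> indicator \<Omega> x"
    by (simp add: dirichlet_heat_def split: split_indicator)
qed measurable

text \<open>The terms are dominated by the exponential series, so sum and integral may be
  interchanged; averaging then turns \<open>survival n\<close> into
  \<open>k (Suc n)\<close>.\<close>

lemma kernel_integral_dirichlet_heat:
  assumes x: "x \<in> space \<nu>"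
  shows "(LINT y|m x. dirichlet_heat t y) = exp_weighted (\<lambda>n. k (Suc n) x) t"
proof -
  interpret prob_space "m x" by (rule prob_space_kernel[OF x])
  have i: "integrable (m x) (\<lambda>y. survival n y / fact n * t ^ n)" for n
    using integrable_kernel_survival[OF x] by simp
  have s1: "\<bar>survival n y\<bar> \<le> 1" if "y \<in> space \<nu>" for n y
    using survival_bounds[OF that, of n] by simp
  have summ: "summable (\<lambda>n. \<bar>survival n y / fact n * t ^ n\<bar>)" if "y \<in> space \<nu>" for y
  proof -
    have "summable (\<lambda>n. \<bar>survival n y\<bar> / fact n * \<bar>t\<bar> ^ n)"
      by (rule summable_exp_weighted[of _ 1]) (simp add: s1 that)
    then show ?thesis by (simp add: abs_mult power_abs)
  qed
  have summ_int: "summable (\<lambda>n. LINT y|m x. norm (survival n y / fact n * t ^ n))"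
  proof -
    have "summable (\<lambda>n. (LINT y|m x. \<bar>survival n y\<bar>) / fact n * \<bar>t\<bar> ^ n)"
    proof (rule summable_exp_weighted)
      fix n
      have "(LINT y|m x. \<bar>survival n y\<bar>) \<le> 1"
        using integrable_kernel_survival[OF x, of n] x
        by (intro integral_le_const AE_I2) (auto simp: space_walk s1)
      moreover have "0 \<le> (LINT y|m x. \<bar>survival n y\<bar>)" by (rule integral_nonneg_AE) simp
      ultimately show "\<bar>LINT y|m x. \<bar>survival n y\<bar>\<bar> \<le> 1" by simp
    qed
    then show ?thesis by (simp add: abs_mult power_abs)
  qed
  have "(LINT y|m x. dirichlet_heat t y) = (LINT y|m x. exp (- t) * (\<Sum>n. survival n y / fact n * t ^ n))"
    by (intro Bochner_Integration.integral_cong refl)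
      (simp add: dirichlet_heat_def exp_weighted_def survival_def split: split_indicator)
  also have "\<dots> = exp (- t) * (LINT y|m x. (\<Sum>n. survival n y / fact n * t ^ n))"
    by simp
  also have "(LINT y|m x. (\<Sum>n. survival n y / fact n * t ^ n)) = (\<Sum>n. LINT y|m x. survival n y / fact n * t ^ n)"
    by (rule integral_suminf[OF i AE_I2 summ_int]) (use summ x in \<open>simp add: space_walk\<close>)
  also have "\<dots> = (\<Sum>n. k (Suc n) x / fact n * t ^ n)"
    by (simp add: iterated_kernel_Suc del: iterated_kernel.simps)
  finally show ?thesis by (simp add: exp_weighted_def del: iterated_kernel.simps)
qed

lemma L2_norm_sq_bounded_le:
  assumes "AE x in \<nu>. x \<in> \<Omega> \<longrightarrow> \<bar>f x\<bar> \<le> b"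
  shows "L2_norm_sq \<nu> \<Omega> f \<le> ennreal (b\<^sup>2) * emeasure \<nu> \<Omega>"
proof -
  have "L2_norm_sq \<nu> \<Omega> f \<le> (\<integral>\<^sup>+x. ennreal (b\<^sup>2) * indicator \<Omega> x \<partial>\<nu>)"
    unfolding L2_norm_sq_def
  proof (rule nn_integral_mono_AE)
    show "AE x in \<nu>. ennreal ((f x)\<^sup>2) * indicator \<Omega> x \<le> ennreal (b\<^sup>2) * indicator \<Omega> x"
      using assms
    proof eventually_elim
      case (elim x)
      then show ?case
        using power_mono[of "\<bar>f x\<bar>" b 2] by (auto split: split_indicator intro!: ennreal_leI)
    qed
  qed
  also have "\<dots> = ennreal (b\<^sup>2) * emeasure \<nu> \<Omega>" by (simp add: nn_integral_cmult)
  finally show ?thesis .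
qed

text \<open>On a set of finite measure, uniform convergence implies L^2 convergence.\<close>

lemma L2_norm_sq_tendsto_0:
  assumes "eventually (\<lambda>h. AE x in \<nu>. x \<in> \<Omega> \<longrightarrow> \<bar>f h x\<bar> \<le> b h) F" and b: "(b \<longlongrightarrow> 0) F"
  shows "((\<lambda>h. L2_norm_sq \<nu> \<Omega> (f h)) \<longlongrightarrow> 0) F"
proof (rule tendsto_sandwich[of "\<lambda>_. 0"])
  show "eventually (\<lambda>h. L2_norm_sq \<nu> \<Omega> (f h) \<le> ennreal ((b h)\<^sup>2) * emeasure \<nu> \<Omega>) F"
    using assms(1) by eventually_elim (rule L2_norm_sq_bounded_le)
  have "((\<lambda>h. ennreal ((b h)\<^sup>2) * emeasure \<nu> \<Omega>) \<longlongrightarrow> ennreal (0\<^sup>2) * emeasure \<nu> \<Omega>) F"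
    using finite_domain by (intro tendsto_mult_ennreal tendsto_ennrealI tendsto_power b tendsto_const) auto
  then show "((\<lambda>h. ennreal ((b h)\<^sup>2) * emeasure \<nu> \<Omega>) \<longlongrightarrow> 0) F" by simp
qed auto

text \<open>The boundary and initial values hold by construction. Both limits reduce to the scalar
  estimates for \<open>exp_weighted\<close> with B = 1, which are uniform in x and so give the rates
  2|t| and 4|h|.\<close>

lemma heat_solution_dirichlet_heat: "heat_solution \<nu> m \<Omega> dirichlet_heat"
  unfolding heat_solution_def
proof (intro conjI allI impI)
  have bd: "AE x\<in>m_boundary \<nu> m \<Omega> in \<nu>. dirichlet_heat t x = 0" for t
    by (auto simp: dirichlet_heat_def m_boundary_def)
  then show "AE x\<in>m_boundary \<nu> m \<Omega> in \<nu>. dirichlet_heat t x = 0" for t .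
  show "L2_on \<nu> closure_domain (dirichlet_heat t)" if "0 \<le> t" for t
    using that by (rule L2_on_dirichlet_heat)
  show "AE x\<in>\<Omega> in \<nu>. dirichlet_heat 0 x = 1"
    by (auto simp: dirichlet_heat_def exp_weighted_0)
  show "((\<lambda>t. L2_norm_sq \<nu> \<Omega> (\<lambda>x. dirichlet_heat t x - dirichlet_heat 0 x)) \<longlongrightarrow> 0) (at_right 0)"
  proof (rule L2_norm_sq_tendsto_0[where b = "\<lambda>t. 2 * \<bar>t\<bar>"])
    show "\<forall>\<^sub>F t in at_right 0. AE x in \<nu>. x \<in> \<Omega> \<longrightarrow> \<bar>dirichlet_heat t x - dirichlet_heat 0 x\<bar> \<le> 2 * \<bar>t\<bar>"
      using eventually_at_right_less[of 0]
    proof eventually_elim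
      case (elim t)
      show ?case
      proof (rule AE_I2, rule impI)
        fix x assume "x \<in> space \<nu>" "x \<in> \<Omega>"
        then show "\<bar>dirichlet_heat t x - dirichlet_heat 0 x\<bar> \<le> 2 * \<bar>t\<bar>"
          using abs_exp_weighted_diff_le[of "\<lambda>n. k n x" 1 t 0, OF abs_iterated_kernel_le] elim
          by (simp add: dirichlet_heat_def)
      qed
    qed
  qed (rule tendsto_eq_intros refl | simp)+
  show "((\<lambda>h. L2_norm_sq \<nu> \<Omega> (\<lambda>x. (dirichlet_heat (t + h) x - dirichlet_heat t x) / h
      - (LINT y:closure_domain|m x. dirichlet_heat t y - dirichlet_heat t x))) \<longlongrightarrow> 0) (at 0)"
    if t: "0 < t" for t
  proof (rule L2_norm_sq_tendsto_0[where b = "\<lambda>h. 4 * \<bar>h\<bar>"])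
    \<comment> \<open>The Laplacian is the weighted series of differences, the very derivative in
      the scalar difference-quotient estimate.\<close>
    have lap: "AE x in \<nu>. x \<in> \<Omega> \<longrightarrow> (LINT y:closure_domain|m x. dirichlet_heat t y - dirichlet_heat t x)
       = exp_weighted (\<lambda>n. k (Suc n) x - k n x) t"
      using AE_laplacian_eq[OF L2_on_dirichlet_heat[OF less_imp_le[OF t]] bd] AE_space
    proof eventually_elim
      case (elim x)
      have restrict: "indicator \<Omega> y * dirichlet_heat t y = dirichlet_heat t y" for y
        by (simp add: dirichlet_heat_def split: split_indicator)
      have diff: "exp_weighted (\<lambda>n. k (Suc n) x - k n x) t
        = exp_weighted (\<lambda>n. k (Suc n) x) t - exp_weighted (\<lambda>n. k n x) t"
        by (rule exp_weighted_diff) (rule abs_iterated_kernel_le[OF elim(2)])+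
      show ?case
      proof
        assume x: "x \<in> \<Omega>"
        then have "dirichlet_heat t x = exp_weighted (\<lambda>n. k n x) t"
          by (simp add: dirichlet_heat_def)
        with elim(1)[rule_format, OF x]
        show "(LINT y:closure_domain|m x. dirichlet_heat t y - dirichlet_heat t x)
            = exp_weighted (\<lambda>n. k (Suc n) x - k n x) t"
          unfolding restrict diff kernel_integral_dirichlet_heat[OF elim(2)] by simp
      qed
    qed
    have "eventually (\<lambda>h. h \<in> {- t<..<t}) (at 0)"
      using t by (intro eventually_at_in_open') auto
    moreover have "eventually (\<lambda>h. h \<noteq> 0) (at (0::real))" by (rule eventually_neq_at_within)
    ultimately show "\<forall>\<^sub>F h in at 0. AE x in \<nu>. x \<in> \<Omega> \<longrightarrow>
        \<bar>(dirichlet_heat (t + h) x - dirichlet_heat t x) / h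
          - (LINT y:closure_domain|m x. dirichlet_heat t y - dirichlet_heat t x)\<bar> \<le> 4 * \<bar>h\<bar>"
    proof eventually_elim
      case (elim h)
      then have h: "\<bar>h\<bar> < t" "h \<noteq> 0" by auto
      show ?case
        using lap AE_space
      proof eventually_elim
        case (elim x)
        show ?case
          using exp_weighted_difference_quotient[of "\<lambda>n. k n x" 1 t h, OF abs_iterated_kernel_le[OF elim(2)] t h] elim(1)
          by (simp add: dirichlet_heat_def del: iterated_kernel.simps)
      qed
    qed
  qed (rule tendsto_eq_intros refl | simp)+
qed

text \<open>Existence makes the chosen function a solution, and the formula holds for every
  solution, so the choice has no effect.\<close>

lemma spectral_heat_content_eq:
  assumes "0 \<le> t"
  shows "spectral_heat_content \<nu> m \<Omega> t = exp_weighted g t"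
  unfolding spectral_heat_content_def
  using someI[of "heat_solution \<nu> m \<Omega>", OF heat_solution_dirichlet_heat] assms
  by (rule heat_solution_content)

end

text \<open>Integrability and summability are part of the conclusion, so that the identity does not
  relate default values of a divergent integral or series.\<close>

theorem proposition3p9:
  fixes \<nu> :: "'a measure" and m :: "'a \<Rightarrow> 'a measure" and \<Omega> :: "'a set" and j :: nat
  assumes "reversible_random_walk_space \<nu> m"
    and "\<Omega> \<in> sets \<nu>"
    and "m_connected \<nu> m \<Omega>"
    and "0 < emeasure \<nu> \<Omega>"
    and "emeasure \<nu> \<Omega> < emeasure \<nu> (m_closure \<nu> m \<Omega>)"
    and "emeasure \<nu> (m_closure \<nu> m \<Omega>) < \<infinity>"
    and "poincare2 \<nu> m \<Omega>"
    and "j \<ge> 1"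
  shows "set_integrable lborel {0..} (\<lambda>t. t ^ (j - 1) * spectral_heat_content \<nu> m \<Omega> t) \<and>
         summable (\<lambda>k. real ((k + j - 1) choose (j - 1)) * g_seq \<nu> m \<Omega> k) \<and>
         exit_moment \<nu> m \<Omega> j =
           fact j * (\<Sum>k. real ((k + j - 1) choose (j - 1)) * g_seq \<nu> m \<Omega> k)"
proof -
  interpret sigma_finite_measure \<nu>
    using assms(1) by (simp add: reversible_random_walk_space_def)
  interpret killed_walk \<nu> m \<Omega>
  proof unfold_locales
    show "m \<in> measurable \<nu> (prob_algebra \<nu>)" "reversible \<nu> m"
      using assms(1) by (simp_all add: reversible_random_walk_space_def random_walk_def)
    show "\<Omega> \<in> sets \<nu>" "emeasure \<nu> \<Omega> < \<infinity>" using assms(2,5,6) by auto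
  qed
  obtain r C where r: "0 < r" "r < 1" and gr: "\<And>n. g n \<le> C * r ^ n"
    using g_geometric_decay[OF assms(7)] by blast
  \<comment> \<open>Geometric decay of g allows comparison with the negative binomial series at r <
    1.\<close>
  have summ: "summable (\<lambda>k. real ((k + j - 1) choose (j - 1)) * g k)"
  proof (rule summable_comparison_test')
    show "summable (\<lambda>k. C * (real ((k + j - 1) choose (j - 1)) * r ^ k))"
      using r assms(8) by (intro summable_mult summable_negative_binomial) auto
    show "norm (real ((n + j - 1) choose (j - 1)) * g n) \<le> C * (real ((n + j - 1) choose (j - 1)) * r ^ n)" for n
      using mult_left_mono[OF gr[of n], of "real ((n + j - 1) choose (j - 1))"] g_nonneg[of n]
      by (simp add: abs_mult mult_ac)
  qed
  note moment = integral_exp_weighted_moment[of g "g 0" j, OF g_nonneg g_le assms(8) summ]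
  have "set_integrable lborel {0..} (\<lambda>t. t ^ (j - 1) * spectral_heat_content \<nu> m \<Omega> t)
      \<longleftrightarrow> set_integrable lborel {0..} (\<lambda>t. t ^ (j - 1) * exp_weighted g t)"
    by (intro set_integrable_cong refl) (simp add: spectral_heat_content_eq)
  moreover have "(LINT t:{0..}|lborel. t ^ (j - 1) * spectral_heat_content \<nu> m \<Omega> t)
      = (LINT t:{0..}|lborel. t ^ (j - 1) * exp_weighted g t)"
    by (intro set_lebesgue_integral_cong) (auto simp: spectral_heat_content_eq)
  \<comment> \<open>The factor j in the exit moment turns the (j - 1)! of the Gamma integrals into
    j!.\<close>
  moreover have "real j * fact (j - 1) = fact j"
    using assms(8) by (simp add: fact_reduce)
  ultimately show ?thesis
    using moment summ unfolding exit_moment_def by (simp add: mult.assoc[symmetric])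
qed

end
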